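(* Let $M$ be a smooth manifold of dimension $n\geq 3$, let $\mathbf{G}$ be a spray on $M$ and let $dV$ be a volume form on $M$. Then the Berwald-Weyl curvature $\mathbf{W}^{o}=W^o_k\,dx^k$ of $(\mathbf{G},dV)$ satisfies $$W^{o}_{k}=\frac{1}{n-2}\,W^{m}_{~k\parallel m},$$ where $W^i_{~k}$ is the Weyl curvature of $\mathbf{G}$ and $\parallel$ denotes the horizontal covariant derivative with respect to the projective spray $\hat{\mathbf{G}}$ associated with $(\mathbf{G},dV)$.
   Context: Let $(x^i,y^i)$ be standard local coordinates on $TM$, $TM_0=TM\setminus\{0\}$; the summation convention is used and $f_{\cdot k}=\partial f/\partial y^k$. Spray: a smooth vector field on $TM_0$ of the local form $\mathbf{G}=y^{i}\frac{\partial}{\partial x^{i}}-2G^{i}\frac{\partial}{\partial y^{i}}$ with $G^i(x,\lambda y)=\lambda^2G^i(x,y)$ for all $\lambda>0$. Put $N^i_j=\partial G^i/\partial y^j$, $\Gamma^i_{jk}=\partial^2G^i/\partial y^j\partial y^k$ (Berwald connection), $\frac{\delta}{\delta x^k}=\frac{\partial}{\partial x^k}-N^l_k\frac{\partial}{\partial y^l}$. The horizontal covariant derivative $|$ with respect to $\mathbf{G}$ is that of the Berwald connection: $f_{|k}=\frac{\delta f}{\delta x^k}$, $A_{k|m}=\frac{\delta A_k}{\delta x^m}-\Gamma^l_{km}A_l$, $A^i_{~k|m}=\frac{\delta A^i_{~k}}{\delta x^m}+\Gamma^i_{lm}A^l_{~k}-\Gamma^l_{km}A^i_{~l}$, etc.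 Curvatures of $\mathbf{G}$: Riemann curvature $R^{i}_{~k}=2\frac{\partial G^{i}}{\partial x^{k}}-y^{j}\frac{\partial^{2} G^{i}}{\partial x^{j}\partial y^{k}}+2G^{j}\frac{\partial^{2} G^{i}}{\partial y^{j}\partial y^{k}}-\frac{\partial G^{i}}{\partial y^{s}}\frac{\partial G^{s}}{\partial y^{k}}$; Ricci curvature $\mathbf{Ric}_{G}=R^m_{~m}$; Ricci scalar $R=\frac{1}{n-1}\mathbf{Ric}_G$; $T^i_{~k}=R^i_{~k}-(R\delta^i_k-\frac12R_{\cdot k}y^i)$; $\chi_k=-\frac13T^m_{~k\cdot m}$; Weyl curvature $W^i_{~k}=R^i_{~k}-(R\delta^i_k-\frac12R_{\cdot k}y^i)+\frac{3\chi_k}{n+1}y^i$. For a volume form $dV=\sigma(x)dx^1\cdots dx^n$ ($\sigma>0$), the S-curvature of $(\mathbf{G},dV)$ is $\mathbf{S}=\frac{\partial G^m}{\partial y^m}-y^m\frac{\partial}{\partial x^m}(\ln\sigma)$ (one has $\chi_k=\frac12\{\mathbf{S}_{\cdot k|m}y^m-\mathbf{S}_{|k}\}$). The associated projective spray is $\hat{\mathbf{G}}=\mathbf{G}+\frac{2\mathbf{S}}{n+1}\mathbf{Y}$, $\mathbf{Y}=y^i\frac{\partial}{\partial y^i}$, i.e. $\hat G^i=G^i-\frac{\mathbf{S}}{n+1}y^i$. Let $\hat R=\frac1{n-1}\mathbf{Ric}_{\hat G}$ be the Ricci scalar of $\hat{\mathbf{G}}$, and let $\parallel$ denote the horizontal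 covariant derivative with respect to $\hat{\mathbf{G}}$ (defined as $|$ with $\hat G^i$ in place of $G^i$). The Berwald-Weyl curvature $\mathbf{W}^o=W^o_kdx^k$ of $(\mathbf{G},dV)$ is $W^o_k=\hat R_{\parallel k}-\frac12\hat R_{\cdot k\parallel m}y^m$. *)

theory Defs
  imports "HOL-Analysis.Analysis"
begin

section \<open>Smooth maps between open sets of normed spaces\<close>

primrec Ck_on :: "nat \<Rightarrow> 'a::real_normed_vector set \<Rightarrow> ('a \<Rightarrow> 'b::real_normed_vector) \<Rightarrow> bool" where
  "Ck_on 0 S f \<longleftrightarrow> continuous_on S f"
| "Ck_on (Suc k) S f \<longleftrightarrow> (\<forall>x\<in>S. f differentiable at x) \<and>
     (\<forall>v. Ck_on k S (\<lambda>x. frechet_derivative f (at x) v))"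

text \<open>Only meant for open \<open>S\<close> and finite-dimensional domain.\<close>

definition smooth_on :: "'a::real_normed_vector set \<Rightarrow> ('a \<Rightarrow> 'b::real_normed_vector) \<Rightarrow> bool" where
  "smooth_on S f \<longleftrightarrow> (\<forall>k. Ck_on k S f)"


section \<open>Manifolds, tangent vectors, vector fields, volume forms\<close>

text \<open>A chart is a domain together with a coordinate map; the values of the coordinate map
  outside the domain are irrelevant.\<close>

type_synonym ('p, 'e) chart = "'p set \<times> ('p \<Rightarrow> 'e)"

definition chart_inv :: "('p, 'e) chart \<Rightarrow> 'e \<Rightarrow> 'p" where
  "chart_inv c = inv_into (fst c) (snd c)"

definition transition :: "('p, 'e) chart \<Rightarrow> ('p, 'e) chart \<Rightarrow> 'e \<Rightarrow> 'e" where
  "transition c d = snd d \<circ> chart_inv c"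

definition smooth_manifold ::
  "'p topology \<Rightarrow> ('p, 'e::euclidean_space) chart set \<Rightarrow> bool" where
  "smooth_manifold M A \<longleftrightarrow>
     Hausdorff_space M \<and>
     (\<exists>\<B>. countable \<B> \<and> (\<forall>U. openin M U \<longleftrightarrow> (\<exists>\<C>\<subseteq>\<B>. U = \<Union>\<C>))) \<and>
     (\<Union>c\<in>A. fst c) = topspace M \<and>
     (\<forall>c\<in>A. openin M (fst c) \<and> open (snd c ` fst c) \<and>
        homeomorphic_map (subtopology M (fst c)) (top_of_set (snd c ` fst c)) (snd c)) \<and>
     (\<forall>c\<in>A. \<forall>d\<in>A. smooth_on (snd c ` (fst c \<inter> fst d)) (transition c d))"

text \<open>A tangent vector at \<open>p\<close> is the family of its components in the charts around \<open>p\<close>, related by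
  the Jacobians of the chart transitions. It is set to zero at all other arguments, so that equality
  of tangent vectors is equality of functions.\<close>

definition tangent_space ::
  "('p, 'e::real_normed_vector) chart set \<Rightarrow> 'p \<Rightarrow> (('p, 'e) chart \<Rightarrow> 'e) set" where
  "tangent_space A p =
     {v. (\<forall>c\<in>A. \<forall>d\<in>A. p \<in> fst c \<longrightarrow> p \<in> fst d \<longrightarrow>
            v d = frechet_derivative (transition c d) (at (snd c p)) (v c)) \<and>
         (\<forall>c. \<not> (c \<in> A \<and> p \<in> fst c) \<longrightarrow> v c = 0)}"

text \<open>The slit tangent bundle \<open>TM\<^sub>0\<close> is the manifold of all \<open>(p, v)\<close> with \<open>v\<close> a nonzero tangent vector
  at \<open>p\<close>; its atlas consists of the standard local coordinates \<open>(x, y)\<close> induced by the charts of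
  \<open>M\<close>.\<close>

definition slit_chart ::
  "('p, 'e::real_normed_vector) chart set \<Rightarrow> ('p, 'e) chart \<Rightarrow>
   ('p \<times> (('p, 'e) chart \<Rightarrow> 'e), 'e \<times> 'e) chart" where
  "slit_chart A c =
     ({(p, v). p \<in> fst c \<and> v \<in> tangent_space A p \<and> v \<noteq> (\<lambda>_. 0)}, \<lambda>(p, v). (snd c p, v c))"

definition smooth_vector_field ::
  "('p, 'e::real_normed_vector) chart set \<Rightarrow> ('p \<Rightarrow> ('p, 'e) chart \<Rightarrow> 'e) \<Rightarrow> bool" where
  "smooth_vector_field A X \<longleftrightarrow>
     (\<forall>p\<in>(\<Union>c\<in>A. fst c). X p \<in> tangent_space A p) \<and>
     (\<forall>c\<in>A. smooth_on (snd c ` fst c) (\<lambda>x. X (chart_inv c x) c))"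

text \<open>A volume form \<open>dV = \<sigma> dx\<^sup>1 \<dots> dx\<^sup>n\<close> with \<open>\<sigma> > 0\<close> is given by its values \<open>\<mu> p c = \<sigma>(p)\<close> in the
  charts \<open>c\<close> around \<open>p\<close>. With the absolute value of the Jacobian determinant, orientability of the
  manifold is not needed; in an oriented atlas these are precisely the positive \<open>n\<close>-forms.\<close>

definition volume_form ::
  "('p, real^'n) chart set \<Rightarrow> ('p \<Rightarrow> ('p, real^'n) chart \<Rightarrow> real) \<Rightarrow> bool" where
  "volume_form A \<mu> \<longleftrightarrow>
     (\<forall>c\<in>A. \<forall>d\<in>A. \<forall>p\<in>fst c \<inter> fst d.
        \<mu> p c = \<bar>det (jacobian (transition c d) (at (snd c p)))\<bar> * \<mu> p d) \<and>
     (\<forall>c\<in>A. (\<forall>p\<in>fst c. \<mu> p c > 0) \<and> smooth_on (snd c ` fst c) (\<lambda>x. \<mu> (chart_inv c x) c))"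

definition volume_density ::
  "('p \<Rightarrow> ('p, real^'n) chart \<Rightarrow> real) \<Rightarrow> ('p, real^'n) chart \<Rightarrow> real^'n \<Rightarrow> real" where
  "volume_density \<mu> c x = \<mu> (chart_inv c x) c"


section \<open>Sprays\<close>

type_synonym ('p, 'n) tm_point = "'p \<times> (('p, real^'n) chart \<Rightarrow> real^'n)"
type_synonym ('p, 'n) tm_chart = "(('p, 'n) tm_point, (real^'n) \<times> (real^'n)) chart"
type_synonym ('p, 'n) tm_field =
  "('p, 'n) tm_point \<Rightarrow> ('p, 'n) tm_chart \<Rightarrow> (real^'n) \<times> (real^'n)"

text \<open>The components of a vector field on \<open>TM\<^sub>0\<close> in the coordinates \<open>(x, y)\<close> induced by \<open>c\<close>: the
  coefficients of \<open>\<partial>/\<partial>x\<^sup>i\<close> and of \<open>\<partial>/\<partial>y\<^sup>i\<close>.\<close>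

definition tm_components ::
  "('p, real^'n) chart set \<Rightarrow> ('p, 'n) tm_field \<Rightarrow> ('p, real^'n) chart \<Rightarrow>
   (real^'n) \<times> (real^'n) \<Rightarrow> (real^'n) \<times> (real^'n)" where
  "tm_components A X c z = X (chart_inv (slit_chart A c) z) (slit_chart A c)"

definition spray_coeff ::
  "('p, real^'n) chart set \<Rightarrow> ('p, 'n) tm_field \<Rightarrow> ('p, real^'n) chart \<Rightarrow>
   (real^'n) \<times> (real^'n) \<Rightarrow> real^'n" where
  "spray_coeff A X c z = (- 1 / 2) *\<^sub>R snd (tm_components A X c z)"

definition spray :: "('p, real^'n) chart set \<Rightarrow> ('p, 'n) tm_field \<Rightarrow> bool" where
  "spray A X \<longleftrightarrow>
     smooth_vector_field (slit_chart A ` A) X \<and>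
     (\<forall>c\<in>A. \<forall>x\<in>snd c ` fst c. \<forall>y. y \<noteq> 0 \<longrightarrow>
        fst (tm_components A X c (x, y)) = y \<and>
        (\<forall>t>0. spray_coeff A X c (x, t *\<^sub>R y) = t\<^sup>2 *\<^sub>R spray_coeff A X c (x, y)))"


section \<open>Local expressions in standard coordinates of the slit tangent bundle\<close>

text \<open>From here on, everything is a function of \<open>z = (x, y)\<close>; the argument \<open>G\<close> is the vector of spray
  coefficients \<open>G\<^sup>i(x, y)\<close>. Tensor components take their indices in the order in which they are
  written, upper index first.\<close>

type_synonym 'n scalar = "(real^'n) \<times> (real^'n) \<Rightarrow> real"
type_synonym 'n coeffs = "(real^'n) \<times> (real^'n) \<Rightarrow> real^'n"

definition dx :: "'n::finite \<Rightarrow> 'n scalar \<Rightarrow> 'n scalar" where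
  "dx k f z = frechet_derivative f (at z) (axis k 1, 0)"

definition dy :: "'n::finite \<Rightarrow> 'n scalar \<Rightarrow> 'n scalar" where
  "dy k f z = frechet_derivative f (at z) (0, axis k 1)"

definition nonlin_conn :: "'n::finite coeffs \<Rightarrow> 'n \<Rightarrow> 'n \<Rightarrow> 'n scalar" where
  "nonlin_conn G i j = dy j (\<lambda>z. G z $ i)"

definition berwald_conn :: "'n::finite coeffs \<Rightarrow> 'n \<Rightarrow> 'n \<Rightarrow> 'n \<Rightarrow> 'n scalar" where
  "berwald_conn G i j k = dy j (dy k (\<lambda>z. G z $ i))"

definition delta_dx :: "'n::finite coeffs \<Rightarrow> 'n \<Rightarrow> 'n scalar \<Rightarrow> 'n scalar" where
  "delta_dx G k f z = dx k f z - (\<Sum>l\<in>UNIV. nonlin_conn G l k z * dy l f z)"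

text \<open>Horizontal covariant derivatives of \<open>f\<close>, \<open>A\<^sub>k\<close> and \<open>A\<^sup>i\<^sub>k\<close>; the last index is that of
  differentiation.\<close>

definition hcov_scalar :: "'n::finite coeffs \<Rightarrow> 'n scalar \<Rightarrow> 'n \<Rightarrow> 'n scalar" where
  "hcov_scalar G f k = delta_dx G k f"

definition hcov_covector ::
  "'n::finite coeffs \<Rightarrow> ('n \<Rightarrow> 'n scalar) \<Rightarrow> 'n \<Rightarrow> 'n \<Rightarrow> 'n scalar" where
  "hcov_covector G A k m z =
     delta_dx G m (A k) z - (\<Sum>l\<in>UNIV. berwald_conn G l k m z * A l z)"

definition hcov_endo ::
  "'n::finite coeffs \<Rightarrow> ('n \<Rightarrow> 'n \<Rightarrow> 'n scalar) \<Rightarrow> 'n \<Rightarrow> 'n \<Rightarrow> 'n \<Rightarrow> 'n scalar" where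
  "hcov_endo G A i k m z =
     delta_dx G m (A i k) z + (\<Sum>l\<in>UNIV. berwald_conn G i l m z * A l k z)
       - (\<Sum>l\<in>UNIV. berwald_conn G l k m z * A i l z)"

definition riemann_curv :: "'n::finite coeffs \<Rightarrow> 'n \<Rightarrow> 'n \<Rightarrow> 'n scalar" where
  "riemann_curv G i k z =
     2 * dx k (\<lambda>w. G w $ i) z
     - (\<Sum>j\<in>UNIV. snd z $ j * dx j (dy k (\<lambda>w. G w $ i)) z)
     + 2 * (\<Sum>j\<in>UNIV. G z $ j * dy j (dy k (\<lambda>w. G w $ i)) z)
     - (\<Sum>s\<in>UNIV. dy s (\<lambda>w. G w $ i) z * dy k (\<lambda>w. G w $ s) z)"

definition ricci_curv :: "'n::finite coeffs \<Rightarrow> 'n scalar" where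
  "ricci_curv G z = (\<Sum>m\<in>UNIV. riemann_curv G m m z)"

definition ricci_scalar :: "'n::finite coeffs \<Rightarrow> 'n scalar" where
  "ricci_scalar G z = 1 / (real CARD('n) - 1) * ricci_curv G z"

definition T_curv :: "'n::finite coeffs \<Rightarrow> 'n \<Rightarrow> 'n \<Rightarrow> 'n scalar" where
  "T_curv G i k z =
     riemann_curv G i k z
     - (ricci_scalar G z * (if i = k then 1 else 0)
        - 1 / 2 * dy k (ricci_scalar G) z * snd z $ i)"

definition chi_curv :: "'n::finite coeffs \<Rightarrow> 'n \<Rightarrow> 'n scalar" where
  "chi_curv G k z = - (1 / 3) * (\<Sum>m\<in>UNIV. dy m (T_curv G m k) z)"

definition weyl_curv :: "'n::finite coeffs \<Rightarrow> 'n \<Rightarrow> 'n \<Rightarrow> 'n scalar" where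
  "weyl_curv G i k z =
     riemann_curv G i k z
     - (ricci_scalar G z * (if i = k then 1 else 0)
        - 1 / 2 * dy k (ricci_scalar G) z * snd z $ i)
     + 3 * chi_curv G k z / (real CARD('n) + 1) * snd z $ i"

definition S_curv :: "'n::finite coeffs \<Rightarrow> (real^'n \<Rightarrow> real) \<Rightarrow> 'n scalar" where
  "S_curv G \<sigma> z =
     (\<Sum>m\<in>UNIV. dy m (\<lambda>w. G w $ m) z)
     - (\<Sum>m\<in>UNIV. snd z $ m * dx m (\<lambda>w. ln (\<sigma> (fst w))) z)"

definition proj_spray_coeff :: "'n::finite coeffs \<Rightarrow> (real^'n \<Rightarrow> real) \<Rightarrow> 'n coeffs" where
  "proj_spray_coeff G \<sigma> z = G z - (S_curv G \<sigma> z / (real CARD('n) + 1)) *\<^sub>R snd z"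

definition berwald_weyl :: "'n::finite coeffs \<Rightarrow> (real^'n \<Rightarrow> real) \<Rightarrow> 'n \<Rightarrow> 'n scalar" where
  "berwald_weyl G \<sigma> k z =
     (let Gh = proj_spray_coeff G \<sigma>; Rh = ricci_scalar Gh in
      hcov_scalar Gh Rh k z
      - 1 / 2 * (\<Sum>m\<in>UNIV. hcov_covector Gh (\<lambda>j. dy j Rh) k m z * snd z $ m))"

end

theory Submission
  imports Defs
begin

text \<open>In one chart the claim is an identity between functions of \<open>(x, y)\<close>, and it rests on two facts.

  First, the Weyl curvature is invariant under a projective change \<open>G \<mapsto> G + P y\<close>, with \<open>P\<close>
  homogeneous of degree one (\<open>H_weyl_curv\<close>). Indeed the Riemann curvature changes by
  \<open>\<alpha> \<delta>\<^sup>i\<^sub>k + \<beta>\<^sub>k y\<^sup>i\<close> with \<open>\<beta>\<^sub>k y\<^sup>k = - \<alpha>\<close>, and the Weyl curvature is built so as to be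
  insensitive to such a change. The Weyl curvature of \<open>G\<close> may thus be replaced by that of the
  associated projective spray, whose S-curvature vanishes (\<open>berwald_weyl_eq_divergence\<close>).

  Second, for a spray with vanishing S-curvature the divergence of the Weyl curvature can be computed
  (\<open>weyl_divergence\<close>). Let \<open>R\<^sup>i\<^sub>k\<^sub>l = \<delta>\<^sub>k N\<^sup>i\<^sub>l - \<delta>\<^sub>l N\<^sup>i\<^sub>k\<close> be the curvature of the
  nonlinear connection and \<open>\<rho>\<^sub>k = R\<^sup>m\<^sub>m\<^sub>k\<close> its trace. Then \<open>R\<^sup>i\<^sub>k = R\<^sup>i\<^sub>k\<^sub>l y\<^sup>l\<close>, and the
  Jacobi identity for the horizontal fields \<open>\<delta>\<^sub>k\<close> yields the contracted Bianchi identity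
  \<open>R\<^sup>m\<^sub>k\<^sub>|\<^sub>m = Ric\<^sub>|\<^sub>k - \<rho>\<^sub>k\<^sub>|\<^sub>l y\<^sup>l\<close> (\<open>bianchi_contracted\<close>). Vanishing S-curvature makes
  the traced Berwald connection an exact form on the base, whence \<open>\<rho>\<^sub>k = Ric\<^sub>\<cdot>\<^sub>k / 2\<close> and
  \<open>\<chi> = 0\<close> (\<open>dy_ricci_curv\<close>, \<open>chi_curv_zero\<close>). So the Weyl curvature is
  \<open>R\<^sup>i\<^sub>k - R \<delta>\<^sup>i\<^sub>k + R\<^sub>\<cdot>\<^sub>k y\<^sup>i / 2\<close>, and with \<open>y\<close> parallel its divergence is
  \<open>(n - 2) (R\<^sub>|\<^sub>k - R\<^sub>\<cdot>\<^sub>k\<^sub>|\<^sub>m y\<^sup>m / 2)\<close>.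

  What remains is to see that the components of a spray on a manifold are smooth and satisfy Euler's
  relation on an open set, namely the chart range times the nonzero vectors
  (\<open>local_spray_spray_coeff\<close>).\<close>

section \<open>Calculus of smooth functions on open sets\<close>

lemma frechet_derivative_eqI:
  "(f has_derivative F) (at x) \<Longrightarrow> frechet_derivative f (at x) = F"
  using frechet_derivative_at by metis

lemma frechet_derivative_cong_open:
  assumes "open S" "x \<in> S" "\<And>w. w \<in> S \<Longrightarrow> f w = g w"
  shows "frechet_derivative f (at x) = frechet_derivative g (at x)"
proof -
  have "(f has_derivative F) (at x) \<longleftrightarrow> (g has_derivative F) (at x)" for F
    using assms has_derivative_transform_within_open[of f F x UNIV S g]
      has_derivative_transform_within_open[of g F x UNIV S f] by auto
  then show ?thesis by (simp add: frechet_derivative_def)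
qed

lemma Ck_on_cong:
  assumes "open S" "\<And>x. x \<in> S \<Longrightarrow> f x = g x"
  shows "Ck_on k S f \<longleftrightarrow> Ck_on k S g"
  using assms(2)
proof (induction k arbitrary: f g)
  case 0
  then show ?case by (simp cong: continuous_on_cong)
next
  case (Suc k)
  have "f differentiable at x \<longleftrightarrow> g differentiable at x" if "x \<in> S" for x
    using Suc.prems assms(1) that has_derivative_transform_within_open[of f _ x UNIV S g]
      has_derivative_transform_within_open[of g _ x UNIV S f] unfolding differentiable_def by auto
  moreover have "Ck_on k S (\<lambda>x. frechet_derivative f (at x) v) \<longleftrightarrow>
      Ck_on k S (\<lambda>x. frechet_derivative g (at x) v)" for v
    by (rule Suc.IH) (simp add: frechet_derivative_cong_open[OF assms(1) _ Suc.prems])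
  ultimately show ?case by simp
qed

text \<open>Regularity of a function is established by exhibiting a candidate \<open>F\<close> for its derivative; the
  closure properties below rest on this rule.\<close>

lemma Ck_on_SucI:
  assumes "open S" "\<And>x. x \<in> S \<Longrightarrow> (f has_derivative F x) (at x)"
    and "\<And>v. Ck_on k S (\<lambda>x. F x v)"
  shows "Ck_on (Suc k) S f"
proof -
  have "Ck_on k S (\<lambda>x. frechet_derivative f (at x) v)" for v
    using Ck_on_cong[OF assms(1), of "\<lambda>x. frechet_derivative f (at x) v" "\<lambda>x. F x v"] assms
      frechet_derivative_eqI by metis
  moreover have "\<forall>x\<in>S. f differentiable at x"
    using assms(2) differentiable_def by blast
  ultimately show ?thesis by simp
qed

lemma Ck_on_has_derivative:
  "Ck_on (Suc k) S f \<Longrightarrow> x \<in> S \<Longrightarrow> (f has_derivative frechet_derivative f (at x)) (at x)"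
  by (simp add: frechet_derivative_works)

lemma Ck_on_Suc_imp_Ck_on: "Ck_on (Suc k) S f \<Longrightarrow> Ck_on k S f"
proof (induction k arbitrary: f)
  case 0
  then show ?case
    by (auto intro!: continuous_at_imp_continuous_on differentiable_imp_continuous_within)
next
  case (Suc k)
  then show ?case by (metis Ck_on.simps(2))
qed

lemma Ck_on_const: "Ck_on k S (\<lambda>x. c)"
  by (induction k arbitrary: c) auto

lemma Ck_on_bounded_linear_compose:
  assumes "open S" "bounded_linear L" "Ck_on k S f"
  shows "Ck_on k S (\<lambda>x. L (f x))"
  using assms(3)
proof (induction k arbitrary: f)
  case 0
  then show ?case by (auto intro: bounded_linear.continuous_on[OF assms(2)])
next
  case (Suc k)
  show ?case
    by (rule Ck_on_SucI[OF assms(1), where F = "\<lambda>x v. L (frechet_derivative f (at x) v)"])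
      (use Suc in \<open>auto intro!: bounded_linear.has_derivative[OF assms(2)] simp: frechet_derivative_works\<close>)
qed

lemma Ck_on_bounded_linear:
  assumes "open S" "bounded_linear L"
  shows "Ck_on k S L"
proof (cases k)
  case 0
  then show ?thesis using assms by (simp add: linear_continuous_on)
next
  case (Suc j)
  show ?thesis unfolding Suc
    by (rule Ck_on_SucI[OF assms(1), where F = "\<lambda>x. L"])
      (use assms bounded_linear_imp_has_derivative Ck_on_const in \<open>auto\<close>)
qed

lemma Ck_on_add:
  assumes "open S" "Ck_on k S f" "Ck_on k S g"
  shows "Ck_on k S (\<lambda>x. f x + g x)"
  using assms(2,3)
proof (induction k arbitrary: f g)
  case 0
  then show ?case by (auto intro: continuous_intros)
next
  case (Suc k)
  show ?case
    by (rule Ck_on_SucI[OF assms(1), where F = "\<lambda>x v. frechet_derivative f (at x) v +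
        frechet_derivative g (at x) v"])
      (use Suc in \<open>auto intro!: has_derivative_add simp: frechet_derivative_works\<close>)
qed

lemma Ck_on_mult:
  fixes f g :: "'a::real_normed_vector \<Rightarrow> real"
  assumes "open S" "Ck_on k S f" "Ck_on k S g"
  shows "Ck_on k S (\<lambda>x. f x * g x)"
  using assms(2,3)
proof (induction k arbitrary: f g)
  case 0
  then show ?case by (auto intro: continuous_intros)
next
  case (Suc k)
  have fg: "Ck_on k S f" "Ck_on k S g"
    using Suc.prems Ck_on_Suc_imp_Ck_on by blast+
  show ?case
  proof (rule Ck_on_SucI[OF assms(1), where F = "\<lambda>x v. f x * frechet_derivative g (at x) v +
        frechet_derivative f (at x) v * g x"])
    show "Ck_on k S (\<lambda>x. f x * frechet_derivative g (at x) v +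
        frechet_derivative f (at x) v * g x)" for v
      using Suc fg by (auto intro!: Ck_on_add[OF assms(1)])
  qed (use Suc.prems Ck_on_has_derivative in \<open>blast intro: has_derivative_mult\<close>)
qed

lemma Ck_on_inverse:
  fixes f :: "'a::real_normed_vector \<Rightarrow> real"
  assumes "open S" "Ck_on k S f" "\<And>x. x \<in> S \<Longrightarrow> f x \<noteq> 0"
  shows "Ck_on k S (\<lambda>x. inverse (f x))"
  using assms(2)
proof (induction k)
  case 0
  then show ?case using assms by (auto intro: continuous_intros)
next
  case (Suc k)
  have f: "Ck_on k S f"
    using Suc.prems Ck_on_Suc_imp_Ck_on by blast+
  show ?case
  proof (rule Ck_on_SucI[OF assms(1), where F = "\<lambda>x v. (-1) * (inverse (f x) *
        (frechet_derivative f (at x) v * inverse (f x)))"])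
    show "Ck_on k S (\<lambda>x. (-1) * (inverse (f x) *
        (frechet_derivative f (at x) v * inverse (f x))))" for v
      using Suc f by (intro Ck_on_mult[OF assms(1)] Ck_on_const) auto
    show "((\<lambda>x. inverse (f x)) has_derivative (\<lambda>v. (-1) * (inverse (f x) *
        (frechet_derivative f (at x) v * inverse (f x))))) (at x)" if "x \<in> S" for x
      using Deriv.has_derivative_inverse[OF assms(3)[OF that] Ck_on_has_derivative[OF Suc.prems that]]
      by (simp add: mult.assoc)
  qed
qed

lemma Ck_on_ln:
  fixes f :: "'a::real_normed_vector \<Rightarrow> real"
  assumes "open S" "Ck_on k S f" "\<And>x. x \<in> S \<Longrightarrow> f x > 0"
  shows "Ck_on k S (\<lambda>x. ln (f x))"
proof (cases k)
  case 0
  then show ?thesis using assms by (auto intro!: continuous_intros) (metis less_irrefl)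
next
  case (Suc j)
  have f: "Ck_on (Suc j) S f" using assms Suc by simp
  show ?thesis unfolding Suc
  proof (rule Ck_on_SucI[OF assms(1), where F = "\<lambda>x v. frechet_derivative f (at x) v * inverse (f x)"])
    have "Ck_on j S (\<lambda>x. inverse (f x))"
      using Ck_on_inverse[OF assms(1) Ck_on_Suc_imp_Ck_on[OF f]] assms(3) by fastforce
    then show "Ck_on j S (\<lambda>x. frechet_derivative f (at x) v * inverse (f x))" for v
      using f by (auto intro!: Ck_on_mult[OF assms(1)])
    show "((\<lambda>x. ln (f x)) has_derivative (\<lambda>v. frechet_derivative f (at x) v * inverse (f x))) (at x)"
      if "x \<in> S" for x
      using has_derivative_ln[OF assms(3)[OF that] Ck_on_has_derivative[OF f that]]
      by (simp add: mult.commute)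
  qed
qed

lemma Ck_on_compose_fst:
  fixes f :: "'a::real_normed_vector \<Rightarrow> 'c::real_normed_vector"
    and T :: "'b::real_normed_vector set"
  assumes "open S" "open T" "Ck_on k S f"
  shows "Ck_on k (S \<times> T) (\<lambda>z. f (fst z))"
  using assms(3)
proof (induction k arbitrary: f)
  case 0
  then show ?case
    by (auto intro!: continuous_on_compose2[of S f "S \<times> T" fst] continuous_intros)
next
  case (Suc k)
  show ?case
  proof (rule Ck_on_SucI[where F = "\<lambda>z v. frechet_derivative f (at (fst z)) (fst v)"])
    fix z :: "'a \<times> 'b" assume "z \<in> S \<times> T"
    then have "fst z \<in> S" by auto
    with Ck_on_has_derivative[OF Suc.prems] have
      "(f has_derivative frechet_derivative f (at (fst z))) (at (fst z))" by blast
    from has_derivative_compose[OF has_derivative_fst[OF has_derivative_ident] this]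
    show "((\<lambda>z. f (fst z)) has_derivative (\<lambda>v. frechet_derivative f (at (fst z)) (fst v))) (at z)" .
  next
    have "Ck_on k S (\<lambda>x. frechet_derivative f (at x) w)" for w
      using Suc.prems by simp
    then show "Ck_on k (S \<times> T) (\<lambda>z. frechet_derivative f (at (fst z)) (fst v))"
      for v :: "'a \<times> 'b" by (rule Suc.IH)
  qed (simp add: assms open_Times)
qed

text \<open>Schwarz's theorem. The second difference of \<open>f\<close> over a parallelogram with sides \<open>t u\<close>, \<open>t v\<close>
  does not depend on the order of \<open>u\<close> and \<open>v\<close>, and two applications of the mean value theorem
  turn it into \<open>t\<^sup>2\<close> times either mixed derivative at a nearby point; continuity then gives
  equality in the limit.\<close>

lemma second_derivative_symmetric:
  fixes f :: "'a::real_normed_vector \<Rightarrow> real"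
  assumes S: "open S" "x \<in> S" and f: "Ck_on (Suc (Suc 0)) S f"
  shows "frechet_derivative (\<lambda>w. frechet_derivative f (at w) u) (at x) v =
    frechet_derivative (\<lambda>w. frechet_derivative f (at w) v) (at x) u"
proof -
  let ?D = "\<lambda>e w. frechet_derivative f (at w) e"
  let ?H = "\<lambda>e e' w. frechet_derivative (?D e) (at w) e'"
  have D: "(f has_derivative (\<lambda>e. ?D e w)) (at w)" if "w \<in> S" for w
    using Ck_on_has_derivative[OF f that] .
  have H: "(?D e has_derivative (\<lambda>e'. ?H e e' w)) (at w)" if "w \<in> S" for e w
    using f that by (auto simp: frechet_derivative_works)
  have cont: "continuous_on S (?H e e')" for e e'
    using f by simp
  \<comment> \<open>the second difference quotient over a small parallelogram is attained by a mixed derivative\<close>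
  have mean: "\<exists>a b. 0 \<le> a \<and> a \<le> t \<and> 0 \<le> b \<and> b \<le> t \<and>
      f (x + t *\<^sub>R e + t *\<^sub>R e') - f (x + t *\<^sub>R e) - f (x + t *\<^sub>R e') + f x =
      t * t * ?H e e' (x + a *\<^sub>R e + b *\<^sub>R e')"
    if t: "t > 0" and par: "\<And>a b. 0 \<le> a \<Longrightarrow> a \<le> t \<Longrightarrow> 0 \<le> b \<Longrightarrow> b \<le> t \<Longrightarrow>
      x + a *\<^sub>R e + b *\<^sub>R e' \<in> S" for t e e'
  proof -
    have 1: "((\<lambda>a. f (x + a *\<^sub>R e + b *\<^sub>R e')) has_real_derivative ?D e (x + a *\<^sub>R e + b *\<^sub>R e')) (at a)"
      if "0 \<le> a" "a \<le> t" "0 \<le> b" "b \<le> t" for a b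
    proof -
      have "((\<lambda>a. x + a *\<^sub>R e + b *\<^sub>R e') has_derivative (\<lambda>h. h *\<^sub>R e)) (at a)"
        by (auto intro!: derivative_eq_intros)
      from has_derivative_compose[OF this D[OF par[OF that]]]
      show ?thesis
        using linear_scale[OF has_derivative_linear[OF D[OF par[OF that]]]]
        by (simp add: has_field_derivative_def mult.commute[of _ "?D e _"] mult_commute_abs)
    qed
    have "\<exists>a. 0 < a \<and> a < t \<and> (f (x + t *\<^sub>R e + t *\<^sub>R e') - f (x + t *\<^sub>R e + 0 *\<^sub>R e')) -
        (f (x + 0 *\<^sub>R e + t *\<^sub>R e') - f (x + 0 *\<^sub>R e + 0 *\<^sub>R e')) =
        (t - 0) * (?D e (x + a *\<^sub>R e + t *\<^sub>R e') - ?D e (x + a *\<^sub>R e + 0 *\<^sub>R e'))"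
      using t by (intro MVT2[where f = "\<lambda>a. f (x + a *\<^sub>R e + t *\<^sub>R e') - f (x + a *\<^sub>R e + 0 *\<^sub>R e')"]
          DERIV_diff 1) auto
    then obtain a where a: "0 < a" "a < t" and
      fa: "f (x + t *\<^sub>R e + t *\<^sub>R e') - f (x + t *\<^sub>R e) - f (x + t *\<^sub>R e') + f x =
        t * (?D e (x + a *\<^sub>R e + t *\<^sub>R e') - ?D e (x + a *\<^sub>R e + 0 *\<^sub>R e'))"
      by auto
    have 2: "((\<lambda>b. ?D e (x + a *\<^sub>R e + b *\<^sub>R e')) has_real_derivative ?H e e' (x + a *\<^sub>R e + b *\<^sub>R e')) (at b)"
      if "0 \<le> b" "b \<le> t" for b
    proof -
      have in_S: "x + a *\<^sub>R e + b *\<^sub>R e' \<in> S" using par that a by auto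
      have "((\<lambda>b. x + a *\<^sub>R e + b *\<^sub>R e') has_derivative (\<lambda>h. h *\<^sub>R e')) (at b)"
        by (auto intro!: derivative_eq_intros)
      from has_derivative_compose[OF this H[OF in_S]]
      show ?thesis
        using linear_scale[OF has_derivative_linear[OF H[OF in_S]]]
        by (simp add: has_field_derivative_def mult.commute[of _ "?H e e' _"] mult_commute_abs)
    qed
    have "\<exists>b. 0 < b \<and> b < t \<and> ?D e (x + a *\<^sub>R e + t *\<^sub>R e') - ?D e (x + a *\<^sub>R e + 0 *\<^sub>R e') =
        (t - 0) * ?H e e' (x + a *\<^sub>R e + b *\<^sub>R e')"
      using t by (intro MVT2 2) auto
    then obtain b where "0 < b" "b < t" "?D e (x + a *\<^sub>R e + t *\<^sub>R e') - ?D e (x + a *\<^sub>R e + 0 *\<^sub>R e') =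
        t * ?H e e' (x + a *\<^sub>R e + b *\<^sub>R e')" by auto
    with a fa show ?thesis by (intro exI[of _ a] exI[of _ b]) auto
  qed
  have "\<bar>?H u v x - ?H v u x\<bar> \<le> \<epsilon>" if "\<epsilon> > 0" for \<epsilon>
  proof -
    have ev: "eventually (\<lambda>w. dist (?H e e' w) (?H e e' x) < \<epsilon> / 2) (nhds x)" for e e'
    proof -
      have "isCont (?H e e') x"
        using cont S continuous_on_eq_continuous_at by blast
      then have "(?H e e' \<longlongrightarrow> ?H e e' x) (nhds x)"
        unfolding isCont_def by (rule tendsto_at_iff_tendsto_nhds[THEN iffD1])
      then show ?thesis by (rule tendstoD) (use that in simp)
    qed
    obtain d1 where d1: "d1 > 0" "\<And>w. dist w x < d1 \<Longrightarrow> dist (?H u v w) (?H u v x) < \<epsilon> / 2"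
      using ev unfolding eventually_nhds_metric by blast
    obtain d2 where d2: "d2 > 0" "\<And>w. dist w x < d2 \<Longrightarrow> dist (?H v u w) (?H v u x) < \<epsilon> / 2"
      using ev unfolding eventually_nhds_metric by blast
    obtain d3 where d3: "d3 > 0" "ball x d3 \<subseteq> S"
      using S openE by blast
    define d where "d = min d1 (min d2 d3)"
    define t where "t = d / (norm u + norm v + 1)"
    have d0: "d > 0" using d1 d2 d3 by (simp add: d_def)
    have t: "t > 0" using d0 by (simp add: t_def add_nonneg_pos)
    have close: "dist (x + a *\<^sub>R e + b *\<^sub>R e') x < d"
      if ab: "0 \<le> a" "a \<le> t" "0 \<le> b" "b \<le> t" and e: "norm e + norm e' = norm u + norm v" for a b e e'
    proof -
      have "dist (x + a *\<^sub>R e + b *\<^sub>R e') x = norm (a *\<^sub>R e + b *\<^sub>R e')"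
        by (simp add: dist_norm algebra_simps)
      also have "\<dots> \<le> a * norm e + b * norm e'"
        using norm_triangle_ineq[of "a *\<^sub>R e" "b *\<^sub>R e'"] ab by simp
      also have "\<dots> \<le> t * norm e + t * norm e'"
        using ab by (intro add_mono mult_right_mono) auto
      also have "\<dots> = t * (norm u + norm v)" using e by (simp add: distrib_left[symmetric])
      also have "\<dots> < t * (norm u + norm v + 1)" using t by simp
      also have "\<dots> = d"
        unfolding t_def by (simp add: add_nonneg_pos) (smt (verit) norm_ge_zero)
      finally show ?thesis .
    qed
    have par: "x + a *\<^sub>R e + b *\<^sub>R e' \<in> S"
      if "0 \<le> a" "a \<le> t" "0 \<le> b" "b \<le> t" "norm e + norm e' = norm u + norm v" for a b e e'
      using close[OF that] d3 by (auto simp: d_def dist_commute)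
    obtain a b where ab: "0 \<le> a" "a \<le> t" "0 \<le> b" "b \<le> t"
      and 1: "f (x + t *\<^sub>R u + t *\<^sub>R v) - f (x + t *\<^sub>R u) - f (x + t *\<^sub>R v) + f x =
      t * t * ?H u v (x + a *\<^sub>R u + b *\<^sub>R v)"
      using mean[OF t par, of u v] by auto
    obtain a' b' where ab': "0 \<le> a'" "a' \<le> t" "0 \<le> b'" "b' \<le> t"
      and 2: "f (x + t *\<^sub>R v + t *\<^sub>R u) - f (x + t *\<^sub>R v) - f (x + t *\<^sub>R u) + f x =
      t * t * ?H v u (x + a' *\<^sub>R v + b' *\<^sub>R u)"
      using mean[OF t par, of v u] by (auto simp: add.commute)
    have "x + t *\<^sub>R u + t *\<^sub>R v = x + t *\<^sub>R v + t *\<^sub>R u" by (simp add: algebra_simps)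
    with 1 2 have "t * t * ?H u v (x + a *\<^sub>R u + b *\<^sub>R v) = t * t * ?H v u (x + a' *\<^sub>R v + b' *\<^sub>R u)"
      by (smt (verit))
    with t have "?H u v (x + a *\<^sub>R u + b *\<^sub>R v) = ?H v u (x + a' *\<^sub>R v + b' *\<^sub>R u)" by simp
    moreover have "dist (?H u v (x + a *\<^sub>R u + b *\<^sub>R v)) (?H u v x) < \<epsilon> / 2"
      using d1(2) close[OF ab, of u v] by (simp add: d_def)
    moreover have "dist (?H v u (x + a' *\<^sub>R v + b' *\<^sub>R u)) (?H v u x) < \<epsilon> / 2"
      using d2(2) close[OF ab', of v u] by (simp add: d_def)
    ultimately show ?thesis unfolding dist_real_def by linarith
  qed
  then have "\<bar>?H u v x - ?H v u x\<bar> \<le> 0"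
    using field_le_epsilon[of "\<bar>?H u v x - ?H v u x\<bar>" 0] by simp
  then show ?thesis by simp
qed

section \<open>Partial derivatives in the coordinates of the slit tangent bundle\<close>

locale coord_domain =
  fixes D :: "((real^'n::finite) \<times> (real^'n)) set"
  assumes open_D: "open D"
begin

lemma smooth_has_derivative:
  "smooth_on D f \<Longrightarrow> z \<in> D \<Longrightarrow> (f has_derivative frechet_derivative f (at z)) (at z)"
  by (rule Ck_on_has_derivative) (auto simp: smooth_on_def)

lemma smooth_const [simp]: "smooth_on D (\<lambda>z. c)"
  by (simp add: smooth_on_def Ck_on_const)

lemma smooth_add [simp]:
  "smooth_on D f \<Longrightarrow> smooth_on D g \<Longrightarrow> smooth_on D (\<lambda>z. f z + g z)"
  by (simp add: smooth_on_def Ck_on_add open_D)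

lemma smooth_mult [simp]:
  fixes f g :: "'n scalar"
  shows "smooth_on D f \<Longrightarrow> smooth_on D g \<Longrightarrow> smooth_on D (\<lambda>z. f z * g z)"
  by (simp add: smooth_on_def Ck_on_mult open_D)

lemma smooth_minus [simp]:
  fixes f :: "'n scalar"
  shows "smooth_on D f \<Longrightarrow> smooth_on D (\<lambda>z. - f z)"
  using smooth_mult[of "\<lambda>_. - 1" f] by simp

lemma smooth_diff [simp]:
  fixes f g :: "'n scalar"
  shows "smooth_on D f \<Longrightarrow> smooth_on D g \<Longrightarrow> smooth_on D (\<lambda>z. f z - g z)"
  using smooth_add[of f "\<lambda>z. - g z"] by simp

lemma smooth_sum [simp]:
  fixes f :: "'i \<Rightarrow> 'n scalar"
  shows "(\<And>i. i \<in> I \<Longrightarrow> smooth_on D (f i)) \<Longrightarrow> smooth_on D (\<lambda>z. \<Sum>i\<in>I. f i z)"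
  by (induction I rule: infinite_finite_induct) auto

lemma smooth_cdivide [simp]:
  fixes f :: "'n scalar"
  shows "smooth_on D f \<Longrightarrow> smooth_on D (\<lambda>z. f z / c)"
  using smooth_mult[of f "\<lambda>_. inverse c"] by (simp add: divide_inverse)

lemma smooth_fibre_coord [simp]: "smooth_on D (\<lambda>z. snd z $ i)"
  unfolding smooth_on_def
  by (intro allI Ck_on_bounded_linear open_D bounded_linear_compose[OF bounded_linear_vec_nth bounded_linear_snd])

lemma smooth_cong:
  "(\<And>z. z \<in> D \<Longrightarrow> f z = g z) \<Longrightarrow> smooth_on D f \<longleftrightarrow> smooth_on D g"
  using Ck_on_cong[OF open_D] unfolding smooth_on_def by metis

lemma smooth_frechet_derivative:
  "smooth_on D f \<Longrightarrow> smooth_on D (\<lambda>z. frechet_derivative f (at z) v)"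
  unfolding smooth_on_def using Ck_on.simps(2) by blast

lemma smooth_dx [simp]: "smooth_on D f \<Longrightarrow> smooth_on D (dx k f)"
  using smooth_frechet_derivative unfolding dx_def[abs_def] .

lemma smooth_dy [simp]: "smooth_on D f \<Longrightarrow> smooth_on D (dy k f)"
  using smooth_frechet_derivative unfolding dy_def[abs_def] .

lemma frechet_derivative_add:
  assumes "smooth_on D f" "smooth_on D g" "z \<in> D"
  shows "frechet_derivative (\<lambda>z. f z + g z) (at z) =
    (\<lambda>v. frechet_derivative f (at z) v + frechet_derivative g (at z) v)"
  using assms by (intro frechet_derivative_eqI has_derivative_add smooth_has_derivative)

lemma frechet_derivative_mult:
  fixes f g :: "'n scalar"
  assumes "smooth_on D f" "smooth_on D g" "z \<in> D"
  shows "frechet_derivative (\<lambda>z. f z * g z) (at z) =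
    (\<lambda>v. f z * frechet_derivative g (at z) v + frechet_derivative f (at z) v * g z)"
  using assms by (intro frechet_derivative_eqI has_derivative_mult smooth_has_derivative)

lemma partial_const [simp]: "dx k (\<lambda>z. c) z = 0" "dy k (\<lambda>z. c) z = 0"
  by (simp_all add: dx_def dy_def)

lemma partial_add [simp]:
  assumes "smooth_on D f" "smooth_on D g" "z \<in> D"
  shows "dx k (\<lambda>z. f z + g z) z = dx k f z + dx k g z"
    "dy k (\<lambda>z. f z + g z) z = dy k f z + dy k g z"
  by (simp_all add: dx_def dy_def frechet_derivative_add[OF assms])

lemma partial_mult [simp]:
  assumes "smooth_on D f" "smooth_on D g" "z \<in> D"
  shows "dx k (\<lambda>z. f z * g z) z = f z * dx k g z + dx k f z * g z"
    "dy k (\<lambda>z. f z * g z) z = f z * dy k g z + dy k f z * g z"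
  by (simp_all add: dx_def dy_def frechet_derivative_mult[OF assms])

lemma partial_minus [simp]:
  assumes "smooth_on D f" "z \<in> D"
  shows "dx k (\<lambda>z. - f z) z = - dx k f z" "dy k (\<lambda>z. - f z) z = - dy k f z"
  using partial_mult[of "\<lambda>_. -1" f z k] assms by simp_all

lemma partial_diff [simp]:
  assumes "smooth_on D f" "smooth_on D g" "z \<in> D"
  shows "dx k (\<lambda>z. f z - g z) z = dx k f z - dx k g z"
    "dy k (\<lambda>z. f z - g z) z = dy k f z - dy k g z"
  using partial_add[of f "\<lambda>z. - g z" z k] assms by simp_all

lemma partial_cdivide [simp]:
  assumes "smooth_on D f" "z \<in> D"
  shows "dx k (\<lambda>z. f z / c) z = dx k f z / c" "dy k (\<lambda>z. f z / c) z = dy k f z / c"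
  using partial_mult[of f "\<lambda>_. inverse c" z k] assms by (simp_all add: divide_inverse)

lemma partial_sum [simp]:
  assumes "z \<in> D" "\<And>i. i \<in> I \<Longrightarrow> smooth_on D (f i)"
  shows "dx k (\<lambda>z. \<Sum>i\<in>I. f i z) z = (\<Sum>i\<in>I. dx k (f i) z)"
    "dy k (\<lambda>z. \<Sum>i\<in>I. f i z) z = (\<Sum>i\<in>I. dy k (f i) z)"
  using assms(2) by (induction I rule: infinite_finite_induct) (auto simp: assms(1))

lemma partial_fibre_coord [simp]:
  "dx k (\<lambda>z. snd z $ i) z = 0"
  "dy k (\<lambda>z. snd z $ i) z = (if i = k then 1 else 0)"
proof -
  have "frechet_derivative (\<lambda>z. snd z $ i) (at z) = (\<lambda>z. snd z $ i)"
    by (intro frechet_derivative_eqI bounded_linear_imp_has_derivative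
        bounded_linear_compose[OF bounded_linear_vec_nth bounded_linear_snd])
  then show "dx k (\<lambda>z. snd z $ i) z = 0" "dy k (\<lambda>z. snd z $ i) z = (if i = k then 1 else 0)"
    by (simp_all add: dx_def dy_def axis_def)
qed

text \<open>Identities that hold throughout \<open>D\<close> may be differentiated; this is how relations such as Euler's
  enter the computations below.\<close>

lemma partial_cong:
  assumes "z \<in> D" "\<And>w. w \<in> D \<Longrightarrow> f w = g w"
  shows "dx k f z = dx k g z" "dy k f z = dy k g z"
  using frechet_derivative_cong_open[OF open_D assms] by (simp_all add: dx_def dy_def)

lemma partial_commute:
  assumes "smooth_on D f" "z \<in> D"
  shows "dx k (dx l f) z = dx l (dx k f) z"
    "dy k (dy l f) z = dy l (dy k f) z"
    "dx k (dy l f) z = dy l (dx k f) z"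
proof -
  have "Ck_on (Suc (Suc 0)) D f" using assms(1) unfolding smooth_on_def by blast
  note sym = second_derivative_symmetric[OF open_D assms(2) this]
  show "dx k (dx l f) z = dx l (dx k f) z"
    "dy k (dy l f) z = dy l (dy k f) z"
    "dx k (dy l f) z = dy l (dx k f) z"
    unfolding dx_def[abs_def] dy_def[abs_def] by (rule sym)+
qed

subsection \<open>Homogeneity in the fibre direction\<close>

text \<open>Positive homogeneity of degree \<open>r\<close> in \<open>y\<close>, in the infinitesimal form given by Euler's
  theorem. In this form it is inherited by products and partial derivatives by the rules of
  calculus alone, on any open set.\<close>

definition homogeneous :: "real \<Rightarrow> 'n scalar \<Rightarrow> bool" where
  "homogeneous r f \<longleftrightarrow> (\<forall>z\<in>D. (\<Sum>j\<in>UNIV. snd z $ j * dy j f z) = r * f z)"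

lemma euler: "homogeneous r f \<Longrightarrow> z \<in> D \<Longrightarrow> (\<Sum>j\<in>UNIV. snd z $ j * dy j f z) = r * f z"
  by (simp add: homogeneous_def)

lemma homogeneous_cong:
  assumes "\<And>z. z \<in> D \<Longrightarrow> f z = g z"
  shows "homogeneous r f \<longleftrightarrow> homogeneous r g"
proof -
  have "dy j f z = dy j g z" if "z \<in> D" for z j
    using partial_cong(2)[OF that assms] .
  then show ?thesis using assms unfolding homogeneous_def by simp
qed

lemma homogeneous_add:
  assumes "smooth_on D f" "smooth_on D g" "homogeneous r f" "homogeneous r g"
  shows "homogeneous r (\<lambda>z. f z + g z)"
  using assms by (simp add: homogeneous_def distrib_left sum.distrib)

lemma homogeneous_mult:
  assumes "smooth_on D f" "smooth_on D g" "homogeneous r f" "homogeneous s g"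
  shows "homogeneous (r + s) (\<lambda>z. f z * g z)"
  unfolding homogeneous_def
proof
  fix z assume z: "z \<in> D"
  have "(\<Sum>j\<in>UNIV. snd z $ j * dy j (\<lambda>z. f z * g z) z) =
      f z * (\<Sum>j\<in>UNIV. snd z $ j * dy j g z) + (\<Sum>j\<in>UNIV. snd z $ j * dy j f z) * g z"
    using assms z by (simp add: distrib_left sum.distrib sum_distrib_left sum_distrib_right mult_ac)
  also have "\<dots> = f z * (s * g z) + (r * f z) * g z"
    using assms z by (simp add: euler)
  finally show "(\<Sum>j\<in>UNIV. snd z $ j * dy j (\<lambda>z. f z * g z) z) = (r + s) * (f z * g z)"
    by (simp add: algebra_simps)
qed

lemma homogeneous_const: "homogeneous 0 (\<lambda>z. c)"
  by (simp add: homogeneous_def)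

lemma homogeneous_cmult:
  assumes "smooth_on D f" "homogeneous r f"
  shows "homogeneous r (\<lambda>z. c * f z)"
  using homogeneous_mult[OF smooth_const assms(1) homogeneous_const assms(2)] by simp

lemma homogeneous_diff:
  assumes "smooth_on D f" "smooth_on D g" "homogeneous r f" "homogeneous r g"
  shows "homogeneous r (\<lambda>z. f z - g z)"
  using assms by (simp add: homogeneous_def right_diff_distrib sum_subtractf)

lemma homogeneous_sum:
  assumes "\<And>i. i \<in> I \<Longrightarrow> smooth_on D (f i)" "\<And>i. i \<in> I \<Longrightarrow> homogeneous r (f i)"
  shows "homogeneous r (\<lambda>z. \<Sum>i\<in>I. f i z)"
  unfolding homogeneous_def
proof
  fix z assume z: "z \<in> D"
  have "(\<Sum>j\<in>UNIV. snd z $ j * dy j (\<lambda>z. \<Sum>i\<in>I. f i z) z) =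
      (\<Sum>i\<in>I. \<Sum>j\<in>UNIV. snd z $ j * dy j (f i) z)"
    using assms z by (simp add: sum_distrib_left sum.swap[of _ UNIV])
  also have "\<dots> = (\<Sum>i\<in>I. r * f i z)"
    using assms z by (intro sum.cong refl euler)
  finally show "(\<Sum>j\<in>UNIV. snd z $ j * dy j (\<lambda>z. \<Sum>i\<in>I. f i z) z) = r * (\<Sum>i\<in>I. f i z)"
    by (simp add: sum_distrib_left)
qed

lemma homogeneous_fibre_coord: "homogeneous 1 (\<lambda>z. snd z $ i)"
  by (simp add: homogeneous_def if_distrib cong: if_cong)

lemma homogeneous_dx:
  assumes "smooth_on D f" "homogeneous r f"
  shows "homogeneous r (dx k f)"
  unfolding homogeneous_def
proof
  fix z assume z: "z \<in> D"
  have "(\<Sum>j\<in>UNIV. snd z $ j * dy j (dx k f) z) = dx k (\<lambda>w. \<Sum>j\<in>UNIV. snd w $ j * dy j f w) z"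
    using assms z by (simp add: partial_commute)
  also have "\<dots> = dx k (\<lambda>w. r * f w) z"
    by (rule partial_cong(1)[OF z euler[OF assms(2)]])
  finally show "(\<Sum>j\<in>UNIV. snd z $ j * dy j (dx k f) z) = r * dx k f z"
    using assms z by simp
qed

lemma homogeneous_dy:
  assumes "smooth_on D f" "homogeneous r f"
  shows "homogeneous (r - 1) (dy k f)"
  unfolding homogeneous_def
proof
  fix z assume z: "z \<in> D"
  have "(\<Sum>j\<in>UNIV. snd z $ j * dy j (dy k f) z) + dy k f z =
      dy k (\<lambda>w. \<Sum>j\<in>UNIV. snd w $ j * dy j f w) z"
    using assms z
    by (simp add: partial_commute(2)[of f z _ k] sum.distrib if_distrib[of "\<lambda>x. x * _"] cong: if_cong)
  also have "\<dots> = dy k (\<lambda>w. r * f w) z"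
    by (rule partial_cong(2)[OF z euler[OF assms(2)]])
  finally show "(\<Sum>j\<in>UNIV. snd z $ j * dy j (dy k f) z) = (r - 1) * dy k f z"
    using assms z by (simp add: algebra_simps)
qed

end

section \<open>The nonlinear connection and its curvature\<close>

text \<open>A spray as seen in one chart; \<open>D\<close> stands for the product of the chart range with the nonzero
  vectors.\<close>

locale local_spray = coord_domain D for D :: "((real^'n::finite) \<times> (real^'n)) set" +
  fixes G :: "'n coeffs"
  assumes smooth_G [simp]: "\<And>i. smooth_on D (\<lambda>z. G z $ i)"
    and homogeneous_G: "\<And>i. homogeneous 2 (\<lambda>z. G z $ i)"
begin

abbreviation N :: "'n \<Rightarrow> 'n \<Rightarrow> 'n scalar" where "N \<equiv> nonlin_conn G"
abbreviation \<Gamma> :: "'n \<Rightarrow> 'n \<Rightarrow> 'n \<Rightarrow> 'n scalar" where "\<Gamma> \<equiv> berwald_conn G"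
abbreviation \<delta> :: "'n \<Rightarrow> 'n scalar \<Rightarrow> 'n scalar" where "\<delta> \<equiv> delta_dx G"

lemma smooth_N [simp]: "smooth_on D (N i j)"
  by (simp add: nonlin_conn_def)

lemma dy_N: "dy j (N i k) = \<Gamma> i j k"
  by (simp add: nonlin_conn_def berwald_conn_def)

lemma smooth_berwald [simp]: "smooth_on D (\<Gamma> i j k)"
  by (simp flip: dy_N)

lemma berwald_sym: "z \<in> D \<Longrightarrow> \<Gamma> i j k z = \<Gamma> i k j z"
  unfolding berwald_conn_def by (rule partial_commute(2)[OF smooth_G])

lemma homogeneous_N: "homogeneous 1 (N i j)"
  using homogeneous_dy[OF smooth_G homogeneous_G, of j i] by (simp add: nonlin_conn_def)

lemma N_fibre: "z \<in> D \<Longrightarrow> (\<Sum>j\<in>UNIV. snd z $ j * N i j z) = 2 * G z $ i"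
  using euler[OF homogeneous_G] by (simp add: nonlin_conn_def)

lemma berwald_fibre: "z \<in> D \<Longrightarrow> (\<Sum>j\<in>UNIV. snd z $ j * \<Gamma> i j k z) = N i k z"
  using euler[OF homogeneous_N, of z i k] by (simp add: dy_N)

lemma smooth_delta [simp]: "smooth_on D f \<Longrightarrow> smooth_on D (\<delta> k f)"
  unfolding delta_dx_def[abs_def] by simp

lemma delta_const [simp]: "\<delta> k (\<lambda>z. c) z = 0"
  by (simp add: delta_dx_def)

lemma delta_add [simp]:
  "smooth_on D f \<Longrightarrow> smooth_on D g \<Longrightarrow> z \<in> D \<Longrightarrow> \<delta> k (\<lambda>z. f z + g z) z = \<delta> k f z + \<delta> k g z"
  by (simp add: delta_dx_def distrib_left sum.distrib)

lemma delta_mult [simp]: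
  "smooth_on D f \<Longrightarrow> smooth_on D g \<Longrightarrow> z \<in> D \<Longrightarrow>
    \<delta> k (\<lambda>z. f z * g z) z = f z * \<delta> k g z + \<delta> k f z * g z"
  by (simp add: delta_dx_def distrib_left distrib_right left_diff_distrib right_diff_distrib
      sum.distrib sum_distrib_left sum_distrib_right mult_ac)

lemma delta_diff [simp]:
  "smooth_on D f \<Longrightarrow> smooth_on D g \<Longrightarrow> z \<in> D \<Longrightarrow> \<delta> k (\<lambda>z. f z - g z) z = \<delta> k f z - \<delta> k g z"
  by (simp add: delta_dx_def right_diff_distrib sum_subtractf)

lemma delta_minus [simp]:
  "smooth_on D f \<Longrightarrow> z \<in> D \<Longrightarrow> \<delta> k (\<lambda>z. - f z) z = - \<delta> k f z"
  by (simp add: delta_dx_def sum_negf)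

lemma delta_sum [simp]:
  assumes "z \<in> D" "\<And>i. i \<in> I \<Longrightarrow> smooth_on D (f i)"
  shows "\<delta> k (\<lambda>z. \<Sum>i\<in>I. f i z) z = (\<Sum>i\<in>I. \<delta> k (f i) z)"
  using assms(2) by (induction I rule: infinite_finite_induct) (auto simp: assms(1))

lemma delta_fibre_coord [simp]: "\<delta> k (\<lambda>z. snd z $ i) z = - N i k z"
  by (simp add: delta_dx_def if_distrib cong: if_cong)

lemma delta_cong: "z \<in> D \<Longrightarrow> (\<And>w. w \<in> D \<Longrightarrow> f w = g w) \<Longrightarrow> \<delta> k f z = \<delta> k g z"
  unfolding delta_dx_def using partial_cong[of z f g] by simp

text \<open>The horizontal fields \<open>\<delta>\<^sub>m\<close> and the vertical fields do not commute; the Berwald connection is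
  exactly their bracket.\<close>

lemma delta_dy:
  assumes f: "smooth_on D f" and z: "z \<in> D"
  shows "\<delta> m (dy s f) z = dy s (\<delta> m f) z + (\<Sum>t\<in>UNIV. \<Gamma> t s m z * dy t f z)"
proof -
  have "dy s (\<delta> m f) z = dy s (dx m f) z -
      (\<Sum>t\<in>UNIV. N t m z * dy s (dy t f) z + \<Gamma> t s m z * dy t f z)"
    unfolding delta_dx_def[abs_def] using f z by (simp add: dy_N)
  then show ?thesis
    using f z by (simp add: delta_dx_def partial_commute sum.distrib)
qed

text \<open>Each \<open>\<delta>\<^sub>m\<close> preserves the degree: \<open>N\<^sup>l\<^sub>m\<close> raises it by one and \<open>\<partial>/\<partial>y\<^sup>l\<close> lowers it by one.\<close>

lemma homogeneous_delta:
  assumes f: "smooth_on D f" and hom: "homogeneous r f"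
  shows "homogeneous r (\<delta> m f)"
proof -
  have "homogeneous (1 + (r - 1)) (\<lambda>z. N l m z * dy l f z)" for l
    using f by (intro homogeneous_mult homogeneous_N homogeneous_dy hom smooth_dy) simp_all
  then show ?thesis
    unfolding delta_dx_def[abs_def]
    using f by (intro homogeneous_diff homogeneous_sum homogeneous_dx hom) simp_all
qed

text \<open>The curvature \<open>R\<^sup>i\<^sub>k\<^sub>l\<close> of the nonlinear connection, the obstruction to integrability of the
  horizontal distribution. The Riemann curvature is its contraction with \<open>y\<close>, and the Bianchi
  identities are most transparent for this three-index object.\<close>

definition conn_curv :: "'n \<Rightarrow> 'n \<Rightarrow> 'n \<Rightarrow> 'n scalar" where
  "conn_curv i k l z = \<delta> k (N i l) z - \<delta> l (N i k) z"

lemma smooth_conn_curv [simp]: "smooth_on D (conn_curv i k l)"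
  unfolding conn_curv_def[abs_def] by simp

lemma conn_curv_antisym: "conn_curv i k l z = - conn_curv i l k z"
  by (simp add: conn_curv_def)

lemma homogeneous_conn_curv: "homogeneous 1 (conn_curv i k l)"
  unfolding conn_curv_def[abs_def]
  by (intro homogeneous_diff homogeneous_delta homogeneous_N) simp_all

lemma delta_delta:
  assumes f: "smooth_on D f" and z: "z \<in> D"
  shows "\<delta> k (\<delta> l f) z - \<delta> l (\<delta> k f) z = - (\<Sum>s\<in>UNIV. conn_curv s k l z * dy s f z)"
proof -
  \<comment> \<open>only the terms in which one vector field differentiates the coefficients of the other survive\<close>
  have expand: "\<delta> k (\<delta> l f) z = dx k (dx l f) z
      - ((\<Sum>t\<in>UNIV. N t k z * dy t (dx l f) z) + (\<Sum>t\<in>UNIV. N t l z * dy t (dx k f) z))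
      + (\<Sum>s\<in>UNIV. \<Sum>t\<in>UNIV. N s l z * N t k z * dy t (dy s f) z)
      - (\<Sum>s\<in>UNIV. \<delta> k (N s l) z * dy s f z)" for k l
  proof -
    have "\<delta> k (\<delta> l f) z = \<delta> k (dx l f) z -
        (\<Sum>s\<in>UNIV. N s l z * \<delta> k (dy s f) z + \<delta> k (N s l) z * dy s f z)"
      unfolding delta_dx_def[of _ l, abs_def] using f z by simp
    also have "(\<Sum>s\<in>UNIV. N s l z * \<delta> k (dy s f) z + \<delta> k (N s l) z * dy s f z) =
        (\<Sum>t\<in>UNIV. N t l z * dy t (dx k f) z)
        - (\<Sum>s\<in>UNIV. \<Sum>t\<in>UNIV. N s l z * N t k z * dy t (dy s f) z)
        + (\<Sum>s\<in>UNIV. \<delta> k (N s l) z * dy s f z)"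
      using f z by (simp add: delta_dx_def[of _ _ "dy _ f"] partial_commute(3) right_diff_distrib
          sum.distrib sum_subtractf sum_distrib_left mult.assoc)
    finally show ?thesis by (simp add: delta_dx_def[of _ _ "dx _ f"])
  qed
  have "(\<Sum>s\<in>UNIV. \<Sum>t\<in>UNIV. N s l z * N t k z * dy t (dy s f) z) =
      (\<Sum>s\<in>UNIV. \<Sum>t\<in>UNIV. N s k z * N t l z * dy t (dy s f) z)"
    by (subst sum.swap) (simp add: partial_commute(2)[OF f z] mult_ac)
  then show ?thesis
    using partial_commute(1)[OF f z, of k l]
    by (simp add: expand[of k l] expand[of l k] conn_curv_def left_diff_distrib sum_subtractf)
qed

text \<open>In the cyclic sum each \<open>\<delta>\<^sub>m \<delta>\<^sub>k N\<^sup>i\<^sub>l\<close> is paired with \<open>\<delta>\<^sub>k \<delta>\<^sub>m N\<^sup>i\<^sub>l\<close>, so that only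
  brackets of horizontal fields applied to \<open>N\<close> remain. In covariant form this reads
  \<open>R\<^sup>i\<^sub>k\<^sub>l\<^sub>|\<^sub>m + cyclic = 0\<close>: the terms in which the connection acts on lower indices cancel
  by the symmetry of \<open>\<Gamma>\<close> and the antisymmetry of \<open>R\<^sup>i\<^sub>k\<^sub>l\<close>.\<close>

lemma bianchi_horizontal:
  assumes z: "z \<in> D"
  shows "\<delta> m (conn_curv i k l) z + \<delta> k (conn_curv i l m) z + \<delta> l (conn_curv i m k) z +
    (\<Sum>s\<in>UNIV. \<Gamma> i s m z * conn_curv s k l z + \<Gamma> i s k z * conn_curv s l m z +
      \<Gamma> i s l z * conn_curv s m k z) = 0"
proof -
  have d: "\<delta> m (conn_curv i k l) z = \<delta> m (\<delta> k (N i l)) z - \<delta> m (\<delta> l (N i k)) z" for k l m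
    unfolding conn_curv_def[abs_def] using z by simp
  have c: "\<delta> k (\<delta> l (N i m)) z - \<delta> l (\<delta> k (N i m)) z =
      - (\<Sum>s\<in>UNIV. \<Gamma> i s m z * conn_curv s k l z)" for k l m
    using delta_delta[OF smooth_N z, of k l] by (simp add: dy_N mult.commute)
  show ?thesis
    using c[of k l m] c[of l m k] c[of m k l] by (simp add: d sum.distrib)
qed

text \<open>The first Bianchi identity of the Berwald connection; it expresses the symmetry of \<open>\<Gamma>\<close> in its
  lower indices.\<close>

lemma bianchi_vertical:
  assumes z: "z \<in> D"
  shows "dy j (conn_curv i k l) z + dy k (conn_curv i l j) z + dy l (conn_curv i j k) z = 0"
proof -
  have d: "dy j (\<delta> k (N i l)) z = \<delta> k (\<Gamma> i j l) z - (\<Sum>t\<in>UNIV. \<Gamma> t j k z * \<Gamma> i t l z)" for j k l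
    using delta_dy[OF smooth_N z, of k j i l] by (simp add: dy_N)
  have s: "\<delta> k (\<Gamma> i j l) z = \<delta> k (\<Gamma> i l j) z" for j k l
    by (rule delta_cong[OF z berwald_sym])
  have "dy j (conn_curv i k l) z = dy j (\<delta> k (N i l)) z - dy j (\<delta> l (N i k)) z" for j k l
    unfolding conn_curv_def[abs_def] using z by simp
  then show ?thesis
    using s[of k j l] s[of l k j] s[of j l k]
    by (simp add: d berwald_sym[OF z, of _ k j] berwald_sym[OF z, of _ l j] berwald_sym[OF z, of _ l k])
qed

lemma riemann_curv_eq:
  assumes z: "z \<in> D"
  shows "riemann_curv G i k z = (\<Sum>l\<in>UNIV. conn_curv i k l z * snd z $ l)"
proof -
  \<comment> \<open>differentiate \<open>N\<^sup>i\<^sub>l y\<^sup>l = 2 G\<^sup>i\<close> in the direction \<open>\<delta>\<^sub>k\<close>\<close>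
  have "\<delta> k (\<lambda>w. \<Sum>l\<in>UNIV. snd w $ l * N i l w) z = \<delta> k (\<lambda>w. 2 * G w $ i) z"
    by (rule delta_cong[OF z N_fibre])
  then have 1: "(\<Sum>l\<in>UNIV. snd z $ l * \<delta> k (N i l) z) =
      2 * \<delta> k (\<lambda>w. G w $ i) z + (\<Sum>l\<in>UNIV. N i l z * N l k z)"
    using z by (simp add: sum.distrib sum_negf sum_subtractf algebra_simps)
  have 2: "\<delta> k (\<lambda>w. G w $ i) z = dx k (\<lambda>w. G w $ i) z - (\<Sum>l\<in>UNIV. N i l z * N l k z)"
    by (simp add: delta_dx_def nonlin_conn_def mult.commute)
  have "(\<Sum>l\<in>UNIV. snd z $ l * (\<Sum>t\<in>UNIV. N t l z * \<Gamma> i t k z)) =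
      (\<Sum>t\<in>UNIV. (\<Sum>l\<in>UNIV. snd z $ l * N t l z) * \<Gamma> i t k z)"
    by (simp add: sum_distrib_left sum_distrib_right mult.assoc) (rule sum.swap)
  also have "\<dots> = 2 * (\<Sum>t\<in>UNIV. G z $ t * \<Gamma> i t k z)"
    by (simp add: N_fibre[OF z] sum_distrib_left mult.assoc)
  finally have 3: "(\<Sum>l\<in>UNIV. snd z $ l * \<delta> l (N i k) z) =
      (\<Sum>l\<in>UNIV. snd z $ l * dx l (N i k) z) - 2 * (\<Sum>t\<in>UNIV. G z $ t * \<Gamma> i t k z)"
    by (simp add: delta_dx_def dy_N right_diff_distrib sum_subtractf)
  have "(\<Sum>l\<in>UNIV. conn_curv i k l z * snd z $ l) =
      (\<Sum>l\<in>UNIV. snd z $ l * \<delta> k (N i l) z) - (\<Sum>l\<in>UNIV. snd z $ l * \<delta> l (N i k) z)"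
    by (simp add: conn_curv_def left_diff_distrib right_diff_distrib sum_subtractf mult.commute)
  then show ?thesis
    unfolding 1 2 3 by (simp add: riemann_curv_def nonlin_conn_def berwald_conn_def)
qed

lemma smooth_riemann [simp]: "smooth_on D (riemann_curv G i k)"
  using smooth_cong[of "riemann_curv G i k" "\<lambda>z. \<Sum>l\<in>UNIV. conn_curv i k l z * snd z $ l"]
  by (simp add: riemann_curv_eq)

lemma homogeneous_riemann: "homogeneous 2 (riemann_curv G i k)"
proof -
  have "homogeneous (1 + 1) (\<lambda>z. conn_curv i k l z * snd z $ l)" for l
    by (intro homogeneous_mult homogeneous_conn_curv homogeneous_fibre_coord) simp_all
  then have "homogeneous 2 (\<lambda>z. \<Sum>l\<in>UNIV. conn_curv i k l z * snd z $ l)"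
    by (intro homogeneous_sum) simp_all
  then show ?thesis
    using homogeneous_cong[of "riemann_curv G i k"] by (simp add: riemann_curv_eq)
qed

lemma smooth_ricci_curv [simp]: "smooth_on D (ricci_curv G)"
  unfolding ricci_curv_def[abs_def] by simp

lemma homogeneous_ricci_curv: "homogeneous 2 (ricci_curv G)"
  unfolding ricci_curv_def[abs_def] by (intro homogeneous_sum homogeneous_riemann) simp

lemma smooth_ricci_scalar [simp]: "smooth_on D (ricci_scalar G)"
  unfolding ricci_scalar_def[abs_def] by simp

lemma homogeneous_ricci_scalar: "homogeneous 2 (ricci_scalar G)"
  unfolding ricci_scalar_def[abs_def] by (intro homogeneous_cmult homogeneous_ricci_curv) simp

lemma ricci_scalar_dy: "z \<in> D \<Longrightarrow> dy k (ricci_scalar G) z = 1 / (real CARD('n) - 1) * dy k (ricci_curv G) z"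
  unfolding ricci_scalar_def[abs_def] by simp

lemma delta_cdivide [simp]:
  "smooth_on D f \<Longrightarrow> z \<in> D \<Longrightarrow> \<delta> k (\<lambda>z. f z / c) z = \<delta> k f z / c"
  using delta_mult[of f "\<lambda>_. inverse c" z k] by (simp add: divide_inverse)

text \<open>The correction term of \<open>T\<close> contributes only multiples of \<open>R\<^sub>\<cdot>\<^sub>k\<close>, by Euler's relation for
  \<open>R\<^sub>\<cdot>\<^sub>k\<close>, so that \<open>\<chi>\<close> is governed by the vertical divergence of the Riemann curvature.\<close>

lemma chi_curv_eq:
  assumes z: "z \<in> D"
  shows "chi_curv G k z = - (1 / 3) * ((\<Sum>m\<in>UNIV. dy m (riemann_curv G m k) z) +
    (real CARD('n) - 1) / 2 * dy k (ricci_scalar G) z)"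
proof -
  let ?R = "ricci_scalar G"
  have "dy m (T_curv G m k) z = dy m (riemann_curv G m k) z - (if m = k then dy m ?R z else 0)
      + 1 / 2 * (dy k ?R z + snd z $ m * dy m (dy k ?R) z)" for m
    unfolding T_curv_def[abs_def] using z by (simp add: field_simps)
  moreover have "(\<Sum>m\<in>UNIV. snd z $ m * dy m (dy k ?R) z) = dy k ?R z"
    using euler[OF homogeneous_dy[OF smooth_ricci_scalar homogeneous_ricci_scalar] z] by simp
  ultimately have "(\<Sum>m\<in>UNIV. dy m (T_curv G m k) z) = (\<Sum>m\<in>UNIV. dy m (riemann_curv G m k) z)
      - dy k ?R z + 1 / 2 * (real CARD('n) * dy k ?R z + dy k ?R z)"
    by (simp add: sum.distrib sum_subtractf flip: sum_divide_distrib)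
  then show ?thesis unfolding chi_curv_def by (simp add: field_simps)
qed

text \<open>Along \<open>y\<close>, horizontal differentiation is differentiation by the spray itself, since
  \<open>y\<^sup>j N\<^sup>t\<^sub>j = 2 G\<^sup>t\<close>.\<close>

lemma fibre_delta:
  assumes "smooth_on D f" "z \<in> D"
  shows "(\<Sum>j\<in>UNIV. snd z $ j * \<delta> j f z) =
    (\<Sum>j\<in>UNIV. snd z $ j * dx j f z) - 2 * (\<Sum>t\<in>UNIV. G z $ t * dy t f z)"
proof -
  have "(\<Sum>j\<in>UNIV. snd z $ j * (\<Sum>t\<in>UNIV. N t j z * dy t f z)) =
      (\<Sum>t\<in>UNIV. (\<Sum>j\<in>UNIV. snd z $ j * N t j z) * dy t f z)"
    by (simp add: sum_distrib_left sum_distrib_right mult.assoc) (rule sum.swap)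
  then show ?thesis
    using assms by (simp add: delta_dx_def right_diff_distrib sum_subtractf N_fibre sum_distrib_left mult.assoc)
qed

lemma dy_fibre_delta:
  assumes f: "smooth_on D f" and z: "z \<in> D"
  shows "dy k (\<lambda>w. \<Sum>j\<in>UNIV. snd w $ j * \<delta> j f w) z =
    \<delta> k f z + (\<Sum>j\<in>UNIV. snd z $ j * \<delta> j (dy k f) z) - (\<Sum>t\<in>UNIV. N t k z * dy t f z)"
proof -
  have "(\<Sum>j\<in>UNIV. snd z $ j * (\<Sum>t\<in>UNIV. \<Gamma> t k j z * dy t f z)) =
      (\<Sum>t\<in>UNIV. (\<Sum>j\<in>UNIV. snd z $ j * \<Gamma> t j k z) * dy t f z)"
    by (simp add: sum_distrib_left sum_distrib_right mult.assoc berwald_sym[OF z, of _ k]) (rule sum.swap)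
  then have "(\<Sum>j\<in>UNIV. snd z $ j * \<delta> j (dy k f) z) =
      (\<Sum>j\<in>UNIV. snd z $ j * dy k (\<delta> j f) z) + (\<Sum>t\<in>UNIV. N t k z * dy t f z)"
    using assms by (simp add: delta_dy berwald_fibre distrib_left sum.distrib)
  then show ?thesis
    using assms by (simp add: sum.distrib if_distrib[of "\<lambda>x. x * _"] cong: if_cong)
qed

lemma homogeneous_delta_fibre:
  assumes "smooth_on D P" "homogeneous r P"
  shows "homogeneous (1 + r) (\<lambda>z. \<Sum>j\<in>UNIV. snd z $ j * \<delta> j P z)"
  using assms
  by (intro homogeneous_sum homogeneous_mult homogeneous_fibre_coord homogeneous_delta) simp_all

section \<open>The contracted Bianchi identity\<close>

definition curv_trace :: "'n \<Rightarrow> 'n scalar" where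
  "curv_trace k z = (\<Sum>m\<in>UNIV. conn_curv m m k z)"

lemma smooth_curv_trace [simp]: "smooth_on D (curv_trace k)"
  unfolding curv_trace_def[abs_def] by simp

lemma homogeneous_curv_trace: "homogeneous 1 (curv_trace k)"
  unfolding curv_trace_def[abs_def] by (intro homogeneous_sum homogeneous_conn_curv) simp

lemma curv_trace_swap: "(\<Sum>m\<in>UNIV. conn_curv m k m z) = - curv_trace k z"
  by (simp add: curv_trace_def conn_curv_antisym[of _ k] sum_negf)

lemma ricci_curv_eq: "z \<in> D \<Longrightarrow> ricci_curv G z = (\<Sum>l\<in>UNIV. curv_trace l z * snd z $ l)"
  unfolding ricci_curv_def curv_trace_def
  by (simp add: riemann_curv_eq sum_distrib_right) (rule sum.swap)

text \<open>Trace the horizontal Bianchi identity over the upper index and one lower index, and contract the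
  remaining free index with \<open>y\<close>, which is parallel, so that \<open>y\<close> may be moved inside the covariant derivatives.\<close>

lemma bianchi_contracted:
  assumes z: "z \<in> D"
  shows "(\<Sum>m\<in>UNIV. hcov_endo G (riemann_curv G) m k m z) =
    hcov_scalar G (ricci_curv G) k z - (\<Sum>l\<in>UNIV. hcov_covector G curv_trace k l z * snd z $ l)"
proof -
  let ?y = "\<lambda>l. snd z $ l"
  have dR: "\<delta> m (riemann_curv G i k) z =
      (\<Sum>l\<in>UNIV. \<delta> m (conn_curv i k l) z * ?y l) - (\<Sum>l\<in>UNIV. conn_curv i k l z * N l m z)" for i k m
    using z by (simp add: delta_cong[OF z riemann_curv_eq] sum.distrib sum_negf sum_subtractf mult.commute)
  have dRic: "\<delta> k (ricci_curv G) z =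
      (\<Sum>l\<in>UNIV. \<delta> k (curv_trace l) z * ?y l) - (\<Sum>l\<in>UNIV. curv_trace l z * N l k z)"
    using z by (simp add: delta_cong[OF z ricci_curv_eq] sum.distrib sum_negf sum_subtractf mult.commute)
  have dtr: "\<delta> k (curv_trace l) z = (\<Sum>m\<in>UNIV. \<delta> k (conn_curv m m l) z)" for k l
    unfolding curv_trace_def[abs_def] using z by simp
  \<comment> \<open>the traced identity, before contraction with \<open>y\<close>\<close>
  have b: "(\<Sum>m\<in>UNIV. \<delta> m (conn_curv m k l) z) - \<delta> k (curv_trace l) z + \<delta> l (curv_trace k) z +
    (\<Sum>m\<in>UNIV. \<Sum>s\<in>UNIV. \<Gamma> m s m z * conn_curv s k l z) +
    (\<Sum>m\<in>UNIV. \<Sum>s\<in>UNIV. \<Gamma> m s k z * conn_curv s l m z) +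
    (\<Sum>m\<in>UNIV. \<Sum>s\<in>UNIV. \<Gamma> m s l z * conn_curv s m k z) = 0" for l
  proof -
    have "\<delta> k (conn_curv m l m) z = - \<delta> k (conn_curv m m l) z" for m
      using z by (simp add: delta_cong[OF z conn_curv_antisym[of m l m]])
    then have "(\<Sum>m\<in>UNIV. \<delta> m (conn_curv m k l) z - \<delta> k (conn_curv m m l) z + \<delta> l (conn_curv m m k) z
       + (\<Sum>s\<in>UNIV. \<Gamma> m s m z * conn_curv s k l z + \<Gamma> m s k z * conn_curv s l m z +
      \<Gamma> m s l z * conn_curv s m k z)) = 0"
      using bianchi_horizontal[OF z, of m m k l for m] by (intro sum.neutral ballI) simp
    then show ?thesis by (simp add: dtr sum.distrib sum_subtractf)
  qed
  have c1: "(\<Sum>l\<in>UNIV. (\<Sum>m\<in>UNIV. \<Sum>s\<in>UNIV. \<Gamma> m s m z * conn_curv s k l z) * ?y l) =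
      (\<Sum>m\<in>UNIV. \<Sum>s\<in>UNIV. \<Gamma> m s m z * riemann_curv G s k z)"
  proof -
    have "(\<Sum>l\<in>UNIV. (\<Sum>m\<in>UNIV. \<Sum>s\<in>UNIV. \<Gamma> m s m z * conn_curv s k l z) * ?y l) =
        (\<Sum>m\<in>UNIV. \<Sum>l\<in>UNIV. \<Sum>s\<in>UNIV. \<Gamma> m s m z * conn_curv s k l z * ?y l)"
      by (simp add: sum_distrib_right) (rule sum.swap)
    also have "\<dots> = (\<Sum>m\<in>UNIV. \<Sum>s\<in>UNIV. \<Sum>l\<in>UNIV. \<Gamma> m s m z * conn_curv s k l z * ?y l)"
      by (rule sum.cong[OF refl], rule sum.swap)
    finally show ?thesis by (simp add: riemann_curv_eq[OF z] sum_distrib_left mult.assoc)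
  qed
  have R': "riemann_curv G s m z = - (\<Sum>l\<in>UNIV. conn_curv s l m z * ?y l)" for s m
    by (simp add: riemann_curv_eq[OF z] conn_curv_antisym[of s m] sum_negf)
  have c2: "(\<Sum>l\<in>UNIV. (\<Sum>m\<in>UNIV. \<Sum>s\<in>UNIV. \<Gamma> m s k z * conn_curv s l m z) * ?y l) =
      - (\<Sum>m\<in>UNIV. \<Sum>s\<in>UNIV. \<Gamma> m s k z * riemann_curv G s m z)"
  proof -
    have "(\<Sum>l\<in>UNIV. (\<Sum>m\<in>UNIV. \<Sum>s\<in>UNIV. \<Gamma> m s k z * conn_curv s l m z) * ?y l) =
        (\<Sum>m\<in>UNIV. \<Sum>l\<in>UNIV. \<Sum>s\<in>UNIV. \<Gamma> m s k z * conn_curv s l m z * ?y l)"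
      by (simp add: sum_distrib_right) (rule sum.swap)
    also have "\<dots> = (\<Sum>m\<in>UNIV. \<Sum>s\<in>UNIV. \<Sum>l\<in>UNIV. \<Gamma> m s k z * conn_curv s l m z * ?y l)"
      by (rule sum.cong[OF refl], rule sum.swap)
    also have "\<dots> = (\<Sum>m\<in>UNIV. \<Sum>s\<in>UNIV. - (\<Gamma> m s k z * riemann_curv G s m z))"
      by (simp add: R' sum_distrib_left mult.assoc)
    finally show ?thesis by (simp add: sum_negf)
  qed
  have c3: "(\<Sum>l\<in>UNIV. (\<Sum>m\<in>UNIV. \<Sum>s\<in>UNIV. \<Gamma> m s l z * conn_curv s m k z) * ?y l) =
      (\<Sum>m\<in>UNIV. \<Sum>s\<in>UNIV. conn_curv s m k z * N m s z)"
  proof -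
    have "(\<Sum>l\<in>UNIV. (\<Sum>m\<in>UNIV. \<Sum>s\<in>UNIV. \<Gamma> m s l z * conn_curv s m k z) * ?y l) =
        (\<Sum>l\<in>UNIV. \<Sum>m\<in>UNIV. \<Sum>s\<in>UNIV. ?y l * \<Gamma> m l s z * conn_curv s m k z)"
      unfolding sum_distrib_right by (intro sum.cong refl, subst berwald_sym[OF z]) (simp add: mult_ac)
    also have "\<dots> = (\<Sum>m\<in>UNIV. \<Sum>l\<in>UNIV. \<Sum>s\<in>UNIV. ?y l * \<Gamma> m l s z * conn_curv s m k z)"
      by (rule sum.swap)
    also have "\<dots> = (\<Sum>m\<in>UNIV. \<Sum>s\<in>UNIV. (\<Sum>l\<in>UNIV. ?y l * \<Gamma> m l s z) * conn_curv s m k z)"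
      unfolding sum_distrib_right by (rule sum.cong[OF refl], rule sum.swap)
    finally show ?thesis by (simp add: berwald_fibre[OF z] mult.commute)
  qed
  \<comment> \<open>what differentiating \<open>y\<close> in \<open>R\<^sup>m\<^sub>k\<^sub>l y\<^sup>l\<close> produces cancels the last connection term\<close>
  have c4: "(\<Sum>m\<in>UNIV. \<Sum>l\<in>UNIV. conn_curv m k l z * N l m z) =
      - (\<Sum>m\<in>UNIV. \<Sum>s\<in>UNIV. conn_curv s m k z * N m s z)"
    by (subst sum.swap) (simp add: conn_curv_antisym[of _ k] sum_negf)
  have "0 = (\<Sum>l\<in>UNIV. ((\<Sum>m\<in>UNIV. \<delta> m (conn_curv m k l) z) - \<delta> k (curv_trace l) z + \<delta> l (curv_trace k) z +
    (\<Sum>m\<in>UNIV. \<Sum>s\<in>UNIV. \<Gamma> m s m z * conn_curv s k l z) +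
    (\<Sum>m\<in>UNIV. \<Sum>s\<in>UNIV. \<Gamma> m s k z * conn_curv s l m z) +
    (\<Sum>m\<in>UNIV. \<Sum>s\<in>UNIV. \<Gamma> m s l z * conn_curv s m k z)) * ?y l)"
    by (simp add: b)
  also have "\<dots> = (\<Sum>l\<in>UNIV. (\<Sum>m\<in>UNIV. \<delta> m (conn_curv m k l) z) * ?y l)
    - (\<Sum>l\<in>UNIV. \<delta> k (curv_trace l) z * ?y l) + (\<Sum>l\<in>UNIV. \<delta> l (curv_trace k) z * ?y l)
    + (\<Sum>m\<in>UNIV. \<Sum>s\<in>UNIV. \<Gamma> m s m z * riemann_curv G s k z)
    - (\<Sum>m\<in>UNIV. \<Sum>s\<in>UNIV. \<Gamma> m s k z * riemann_curv G s m z)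
    + (\<Sum>m\<in>UNIV. \<Sum>s\<in>UNIV. conn_curv s m k z * N m s z)"
    by (simp only: distrib_right left_diff_distrib sum.distrib sum_subtractf c1 c2 c3)
  also have "(\<Sum>l\<in>UNIV. (\<Sum>m\<in>UNIV. \<delta> m (conn_curv m k l) z) * ?y l) =
      (\<Sum>m\<in>UNIV. \<Sum>l\<in>UNIV. \<delta> m (conn_curv m k l) z * ?y l)"
    unfolding sum_distrib_right by (rule sum.swap)
  finally have main: "(\<Sum>m\<in>UNIV. \<delta> m (riemann_curv G m k) z) =
      \<delta> k (ricci_curv G) z + (\<Sum>l\<in>UNIV. curv_trace l z * N l k z) - (\<Sum>l\<in>UNIV. \<delta> l (curv_trace k) z * ?y l)
    - (\<Sum>m\<in>UNIV. \<Sum>s\<in>UNIV. \<Gamma> m s m z * riemann_curv G s k z)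
    + (\<Sum>m\<in>UNIV. \<Sum>s\<in>UNIV. \<Gamma> m s k z * riemann_curv G s m z)"
    by (simp add: dR dRic c4 sum_subtractf)
  have "(\<Sum>m\<in>UNIV. \<Sum>s\<in>UNIV. \<Gamma> m s k z * riemann_curv G s m z) =
      (\<Sum>m\<in>UNIV. \<Sum>l\<in>UNIV. \<Gamma> l k m z * riemann_curv G m l z)"
    by (subst sum.swap) (simp add: berwald_sym[OF z, of _ k])
  moreover have "(\<Sum>l\<in>UNIV. (\<Sum>s\<in>UNIV. \<Gamma> s k l z * curv_trace s z) * ?y l) =
      (\<Sum>s\<in>UNIV. curv_trace s z * N s k z)"
  proof -
    have "(\<Sum>l\<in>UNIV. (\<Sum>s\<in>UNIV. \<Gamma> s k l z * curv_trace s z) * ?y l) =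
        (\<Sum>s\<in>UNIV. curv_trace s z * (\<Sum>l\<in>UNIV. ?y l * \<Gamma> s l k z))"
      unfolding sum_distrib_right sum_distrib_left berwald_sym[OF z, of _ k]
      by (subst sum.swap) (simp add: mult_ac)
    then show ?thesis by (simp add: berwald_fibre[OF z])
  qed
  ultimately show ?thesis
    by (simp add: hcov_endo_def hcov_scalar_def hcov_covector_def main sum.distrib sum_subtractf
        left_diff_distrib)
qed

text \<open>The identity endomorphism and the tautological vector field \<open>y\<close> are parallel, so that the covariant
  derivative passes to the coefficients \<open>f\<close> and \<open>a\<close>.\<close>

lemma hcov_endo_scalar_part:
  assumes f: "smooth_on D f" and a: "smooth_on D (a k)" and A: "smooth_on D (A i k)"
    and B: "\<And>i k w. w \<in> D \<Longrightarrow> B i k w = A i k w - (f w * (if i = k then 1 else 0) - 1 / 2 * a k w * snd w $ i)"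
    and z: "z \<in> D"
  shows "hcov_endo G B i k m z = hcov_endo G A i k m z - (if i = k then hcov_scalar G f m z else 0)
    + 1 / 2 * hcov_covector G a k m z * snd z $ i"
proof -
  let ?kd = "\<lambda>i k. if i = k then 1 else 0 :: real"
  have d: "\<delta> m (B i k) z = \<delta> m (A i k) z - ?kd i k * \<delta> m f z
      + 1 / 2 * (\<delta> m (a k) z * snd z $ i - a k z * N i m z)"
    using assms by (simp add: delta_cong[OF z B] field_simps)
  have N: "(\<Sum>l\<in>UNIV. \<Gamma> i l m z * snd z $ l) = N i m z"
    using berwald_fibre[OF z, of i m] by (simp add: mult.commute)
  have "(\<Sum>l\<in>UNIV. \<Gamma> i l m z * B l k z) = (\<Sum>l\<in>UNIV. \<Gamma> i l m z * A l k z
      - f z * (if l = k then \<Gamma> i l m z else 0) + 1 / 2 * a k z * (\<Gamma> i l m z * snd z $ l))"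
    by (intro sum.cong refl) (simp add: B[OF z] field_simps)
  then have c1: "(\<Sum>l\<in>UNIV. \<Gamma> i l m z * B l k z) = (\<Sum>l\<in>UNIV. \<Gamma> i l m z * A l k z)
      - f z * \<Gamma> i k m z + 1 / 2 * a k z * N i m z"
    by (simp only: sum.distrib sum_subtractf sum_distrib_left[symmetric] N) simp
  have "(\<Sum>l\<in>UNIV. \<Gamma> l k m z * B i l z) = (\<Sum>l\<in>UNIV. \<Gamma> l k m z * A i l z
      - f z * (if i = l then \<Gamma> l k m z else 0) + 1 / 2 * snd z $ i * (\<Gamma> l k m z * a l z))"
    by (intro sum.cong refl) (simp add: B[OF z] field_simps)
  then have c2: "(\<Sum>l\<in>UNIV. \<Gamma> l k m z * B i l z) = (\<Sum>l\<in>UNIV. \<Gamma> l k m z * A i l z)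
      - f z * \<Gamma> i k m z + 1 / 2 * snd z $ i * (\<Sum>l\<in>UNIV. \<Gamma> l k m z * a l z)"
    by (simp only: sum.distrib sum_subtractf sum_distrib_left[symmetric]) simp
  show ?thesis
    unfolding hcov_endo_def hcov_scalar_def hcov_covector_def d c1 c2 by (simp add: field_simps)
qed

end

section \<open>Projective changes and the Weyl curvature\<close>

text \<open>The spray \<open>G + P y\<close> has the same geodesics as \<open>G\<close> up to parametrization.\<close>

locale projective_change = local_spray D G for D :: "((real^'n::finite) \<times> (real^'n)) set" and G +
  fixes P :: "'n scalar"
  assumes smooth_P [simp]: "smooth_on D P" and homogeneous_P: "homogeneous 1 P"
begin

definition H :: "'n coeffs" where "H z = G z + P z *\<^sub>R snd z"

lemma H_nth: "H z $ i = G z $ i + P z * snd z $ i"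
  by (simp add: H_def)

sublocale H: local_spray D H
proof
  fix i
  show "smooth_on D (\<lambda>z. H z $ i)" by (simp add: H_nth)
  have "homogeneous (1 + 1) (\<lambda>z. P z * snd z $ i)"
    by (intro homogeneous_mult homogeneous_P homogeneous_fibre_coord) simp_all
  then show "homogeneous 2 (\<lambda>z. H z $ i)"
    unfolding H_nth by (intro homogeneous_add homogeneous_G) simp_all
qed

lemma H_nonlin_conn:
  "z \<in> D \<Longrightarrow> H.N i k z = N i k z + dy k P z * snd z $ i + (if i = k then P z else 0)"
  by (simp add: nonlin_conn_def H_nth[abs_def])

lemma H_nonlin_conn_trace:
  assumes z: "z \<in> D"
  shows "(\<Sum>m\<in>UNIV. H.N m m z) = (\<Sum>m\<in>UNIV. N m m z) + (real CARD('n) + 1) * P z"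
  using euler[OF homogeneous_P z]
  by (simp add: H_nonlin_conn[OF z] sum.distrib algebra_simps)

text \<open>The change of the Riemann curvature is \<open>\<alpha> \<delta>\<^sup>i\<^sub>k + \<beta>\<^sub>k y\<^sup>i\<close>. Writing \<open>\<beta>\<close> in terms of
  \<open>\<alpha>\<close> and \<open>P\<^sub>|\<^sub>k - P P\<^sub>\<cdot>\<^sub>k\<close> makes its contraction with \<open>y\<close> immediate.\<close>

definition \<alpha> :: "'n scalar" where
  "\<alpha> z = P z * P z - (\<Sum>j\<in>UNIV. snd z $ j * \<delta> j P z)"

definition \<beta> :: "'n \<Rightarrow> 'n scalar" where
  "\<beta> k z = 3 * (\<delta> k P z - P z * dy k P z) + dy k \<alpha> z"

lemma smooth_\<alpha> [simp]: "smooth_on D \<alpha>"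
  unfolding \<alpha>_def[abs_def] by simp

lemma smooth_\<beta> [simp]: "smooth_on D (\<beta> k)"
  unfolding \<beta>_def[abs_def] by simp

lemma homogeneous_\<alpha>: "homogeneous 2 \<alpha>"
proof -
  have "homogeneous (1 + 1) (\<lambda>z. P z * P z)"
    by (intro homogeneous_mult homogeneous_P) simp_all
  moreover have "homogeneous (1 + 1) (\<lambda>z. \<Sum>j\<in>UNIV. snd z $ j * \<delta> j P z)"
    by (rule homogeneous_delta_fibre[OF smooth_P homogeneous_P])
  ultimately show ?thesis
    unfolding \<alpha>_def[abs_def] by (intro homogeneous_diff) simp_all
qed

lemma homogeneous_\<beta>: "homogeneous 1 (\<beta> k)"
proof -
  have "homogeneous (1 + (1 - 1)) (\<lambda>z. P z * dy k P z)"
    by (intro homogeneous_mult homogeneous_dy homogeneous_P) simp_all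
  then have "homogeneous 1 (\<lambda>z. 3 * (\<delta> k P z - P z * dy k P z))"
    by (intro homogeneous_cmult homogeneous_diff homogeneous_delta homogeneous_P) simp_all
  moreover have "homogeneous (2 - 1) (dy k \<alpha>)"
    by (intro homogeneous_dy homogeneous_\<alpha>) simp
  ultimately show ?thesis
    unfolding \<beta>_def[abs_def] by (intro homogeneous_add) simp_all
qed

text \<open>This relation is the reason why the change of the Ricci scalar is \<open>\<alpha>\<close> alone: the trace of
  \<open>\<alpha> \<delta>\<^sup>i\<^sub>k + \<beta>\<^sub>k y\<^sup>i\<close> is \<open>(n - 1) \<alpha>\<close>.\<close>

lemma \<beta>_fibre:
  assumes z: "z \<in> D"
  shows "(\<Sum>k\<in>UNIV. snd z $ k * \<beta> k z) = - \<alpha> z"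
proof -
  have "(\<Sum>k\<in>UNIV. snd z $ k * \<beta> k z) = 3 * ((\<Sum>k\<in>UNIV. snd z $ k * \<delta> k P z)
      - P z * (\<Sum>k\<in>UNIV. snd z $ k * dy k P z)) + (\<Sum>k\<in>UNIV. snd z $ k * dy k \<alpha> z)"
    by (simp add: \<beta>_def sum_distrib_left sum_subtractf sum.distrib algebra_simps)
  then show ?thesis
    using euler[OF homogeneous_P z] euler[OF homogeneous_\<alpha> z] by (simp add: \<alpha>_def)
qed

lemma H_riemann_curv:
  assumes z: "z \<in> D"
  shows "riemann_curv H i k z =
    riemann_curv G i k z + (if i = k then \<alpha> z else 0) + \<beta> k z * snd z $ i"
proof -
  let ?kd = "if i = k then 1 else 0 :: real"
  have kd: "(if i = k then x else 0) = ?kd * x" for x by simp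
  have Nh: "dy k (\<lambda>w. H w $ i) z = N i k z + dy k P z * snd z $ i + (if i = k then P z else 0)"
    if "z \<in> D" for i k z
    using H_nonlin_conn[OF that] by (simp add: nonlin_conn_def)
  have dxH: "dx k (\<lambda>w. H w $ i) z = dx k (\<lambda>w. G w $ i) z + dx k P z * snd z $ i"
    using z by (simp add: H_nth)
  have dNh: "dx j (dy k (\<lambda>w. H w $ i)) z = dx j (N i k) z + dx j (dy k P) z * snd z $ i + ?kd * dx j P z"
    "dy j (dy k (\<lambda>w. H w $ i)) z = \<Gamma> i j k z + dy j (dy k P) z * snd z $ i
      + (if i = j then dy k P z else 0) + ?kd * dy j P z" for j
    using z by (simp_all add: partial_cong[OF z Nh] dy_N)
  have 1: "(\<Sum>j\<in>UNIV. snd z $ j * dx j (dy k (\<lambda>w. H w $ i)) z) =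
      (\<Sum>j\<in>UNIV. snd z $ j * dx j (N i k) z) + (\<Sum>j\<in>UNIV. snd z $ j * dx j (dy k P) z) * snd z $ i
      + ?kd * (\<Sum>j\<in>UNIV. snd z $ j * dx j P z)"
    by (simp add: dNh distrib_left sum.distrib sum_distrib_right sum_distrib_left mult_ac)
  have "(\<Sum>j\<in>UNIV. c j * dy j (dy k (\<lambda>w. H w $ i)) z) =
      (\<Sum>j\<in>UNIV. c j * \<Gamma> i j k z) + (\<Sum>j\<in>UNIV. c j * dy j (dy k P) z) * snd z $ i
      + dy k P z * c i + ?kd * (\<Sum>j\<in>UNIV. c j * dy j P z)" for c
    by (simp add: dNh distrib_left sum.distrib sum_distrib_right sum_distrib_left mult_ac)
      (simp add: if_distrib[of "\<lambda>x. _ * x"] cong: if_cong)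
  note c = this
  have "(\<Sum>j\<in>UNIV. snd z $ j * dy j (dy k P) z) = 0" "(\<Sum>j\<in>UNIV. snd z $ j * dy j P z) = P z"
    using euler[OF homogeneous_dy[OF smooth_P homogeneous_P] z] euler[OF homogeneous_P z] by simp_all
  then have 2: "(\<Sum>j\<in>UNIV. H z $ j * dy j (dy k (\<lambda>w. H w $ i)) z) =
      (\<Sum>j\<in>UNIV. G z $ j * \<Gamma> i j k z) + (\<Sum>j\<in>UNIV. G z $ j * dy j (dy k P) z) * snd z $ i
      + dy k P z * G z $ i + ?kd * (\<Sum>j\<in>UNIV. G z $ j * dy j P z)
      + P z * (N i k z + dy k P z * snd z $ i + ?kd * P z)"
    using c[of "\<lambda>j. G z $ j"] c[of "\<lambda>j. snd z $ j"] berwald_fibre[OF z, of i k]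
    by (simp add: H_nth distrib_right sum.distrib mult.assoc flip: sum_distrib_left)
  have Py: "(\<Sum>s\<in>UNIV. dy s P z * snd z $ s) = P z"
    using euler[OF homogeneous_P z] by (simp add: mult.commute)
  have Ny: "(\<Sum>s\<in>UNIV. N i s z * snd z $ s) = 2 * G z $ i"
    using N_fibre[OF z] by (simp add: mult.commute)
  have NP: "(\<Sum>s\<in>UNIV. c s * (if s = k then P z else 0)) = c k * P z" for c
    by (simp add: if_distrib[of "\<lambda>x. _ * x"] cong: if_cong)
  have PN: "(\<Sum>s\<in>UNIV. (if i = s then P z else 0) * c s) = P z * c i" for c
    by (simp add: if_distrib[of "\<lambda>x. x * _"] cong: if_cong)
  have "(\<Sum>s\<in>UNIV. dy s (\<lambda>w. H w $ i) z * dy k (\<lambda>w. H w $ s) z) =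
      (\<Sum>s\<in>UNIV. N i s z * N s k z) + dy k P z * (\<Sum>s\<in>UNIV. N i s z * snd z $ s)
      + (\<Sum>s\<in>UNIV. N i s z * (if s = k then P z else 0))
      + snd z $ i * (\<Sum>s\<in>UNIV. dy s P z * N s k z)
      + snd z $ i * dy k P z * (\<Sum>s\<in>UNIV. dy s P z * snd z $ s)
      + snd z $ i * (\<Sum>s\<in>UNIV. dy s P z * (if s = k then P z else 0))
      + (\<Sum>s\<in>UNIV. (if i = s then P z else 0) * (N s k z + dy k P z * snd z $ s + (if s = k then P z else 0)))"
    by (simp add: Nh[OF z] distrib_left distrib_right sum.distrib sum_distrib_left mult_ac)
  also have "\<dots> = (\<Sum>s\<in>UNIV. N i s z * N s k z) + 2 * G z $ i * dy k P z + 2 * P z * N i k z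
      + snd z $ i * (\<Sum>s\<in>UNIV. dy s P z * N s k z) + 3 * P z * dy k P z * snd z $ i + ?kd * P z * P z"
    unfolding Py Ny NP PN by (simp add: algebra_simps)
  finally have 3: "(\<Sum>s\<in>UNIV. dy s (\<lambda>w. H w $ i) z * dy k (\<lambda>w. H w $ s) z) = \<dots>" .
  have R: "riemann_curv G i k z = 2 * dx k (\<lambda>w. G w $ i) z - (\<Sum>j\<in>UNIV. snd z $ j * dx j (N i k) z)
      + 2 * (\<Sum>j\<in>UNIV. G z $ j * \<Gamma> i j k z) - (\<Sum>s\<in>UNIV. N i s z * N s k z)"
    by (simp add: riemann_curv_def nonlin_conn_def berwald_conn_def)
  have \<alpha>: "\<alpha> z = P z * P z - (\<Sum>j\<in>UNIV. snd z $ j * dx j P z) + 2 * (\<Sum>t\<in>UNIV. G z $ t * dy t P z)"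
    by (simp add: \<alpha>_def fibre_delta[OF smooth_P z])
  have "dy k \<alpha> z = 2 * P z * dy k P z - dy k (\<lambda>w. \<Sum>j\<in>UNIV. snd w $ j * \<delta> j P w) z"
    unfolding \<alpha>_def[abs_def] using z by (simp del: partial_sum)
  then have \<beta>: "\<beta> k z = 2 * dx k P z - (\<Sum>j\<in>UNIV. snd z $ j * dx j (dy k P) z)
      + 2 * (\<Sum>t\<in>UNIV. G z $ t * dy t (dy k P) z) - P z * dy k P z - (\<Sum>s\<in>UNIV. dy s P z * N s k z)"
    unfolding \<beta>_def dy_fibre_delta[OF smooth_P z] using z
    by (simp add: fibre_delta delta_dx_def[of _ k] mult.commute[of "N _ _ _"])
  show ?thesis
    unfolding riemann_curv_def[of H] dxH 1 2 3 R kd[of "\<alpha> z"] \<alpha> \<beta> by (simp add: algebra_simps)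
qed

lemma H_ricci_scalar:
  assumes z: "z \<in> D" and n: "CARD('n) \<ge> 2"
  shows "ricci_scalar H z = ricci_scalar G z + \<alpha> z"
proof -
  have "ricci_curv H z = ricci_curv G z + (real CARD('n) - 1) * \<alpha> z"
    using \<beta>_fibre[OF z]
    by (simp add: ricci_curv_def H_riemann_curv[OF z] sum.distrib mult.commute algebra_simps)
  then show ?thesis
    using n by (simp add: ricci_scalar_def field_simps)
qed

lemma H_chi_curv:
  assumes z: "z \<in> D" and n: "CARD('n) \<ge> 2"
  shows "chi_curv H k z = chi_curv G k z - (real CARD('n) + 1) / 3 * (\<beta> k z + dy k \<alpha> z / 2)"
proof -
  have R: "dy k (ricci_scalar H) z = dy k (ricci_scalar G) z + dy k \<alpha> z"
    using z by (simp add: partial_cong[OF z H_ricci_scalar[OF _ n]])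
  have "dy m (riemann_curv H m k) z = dy m (riemann_curv G m k) z + (if m = k then dy k \<alpha> z else 0)
      + (\<beta> k z + snd z $ m * dy m (\<beta> k) z)" for m
    using z by (simp add: partial_cong[OF z H_riemann_curv] mult.commute)
  then have "(\<Sum>m\<in>UNIV. dy m (riemann_curv H m k) z) = (\<Sum>m\<in>UNIV. dy m (riemann_curv G m k) z)
      + dy k \<alpha> z + (real CARD('n) + 1) * \<beta> k z"
    using euler[OF homogeneous_\<beta> z, of k] by (simp add: sum.distrib algebra_simps)
  then show ?thesis
    by (simp add: chi_curv_eq[OF z] H.chi_curv_eq[OF z] R field_simps)
qed

text \<open>Projective invariance of the Weyl curvature. Passing to the trace-adjusted part removes \<open>\<alpha> \<delta>\<^sup>i\<^sub>k\<close>
  from the change of the Riemann curvature and leaves \<open>(\<beta>\<^sub>k + \<alpha>\<^sub>\<cdot>\<^sub>k / 2) y\<^sup>i\<close>; the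
  coefficient is homogeneous of degree one, so the vertical divergence of this term is
  \<open>n + 1\<close> times the coefficient, and the \<open>\<chi>\<close>-term of the Weyl curvature subtracts exactly that.\<close>

lemma H_weyl_curv:
  assumes z: "z \<in> D" and n: "CARD('n) \<ge> 2"
  shows "weyl_curv H i k z = weyl_curv G i k z"
proof -
  have R: "dy k (ricci_scalar H) z = dy k (ricci_scalar G) z + dy k \<alpha> z"
    using z by (simp add: partial_cong[OF z H_ricci_scalar[OF _ n]])
  define c where "c = real CARD('n) + 1"
  have "c \<noteq> 0" by (simp add: c_def)
  then show ?thesis
    by (simp add: weyl_curv_def R H_ricci_scalar[OF z n] H_chi_curv[OF z n] H_riemann_curv[OF z]
        flip: c_def) (simp add: field_simps)
qed

end

section \<open>Sprays with vanishing S-curvature\<close>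

text \<open>Here \<open>L\<close> is the logarithm of a volume density on the base, and the trace condition says that the
  S-curvature with respect to that density is zero.\<close>

locale unimodular_spray = local_spray D G for D :: "((real^'n::finite) \<times> (real^'n)) set" and G +
  fixes L :: "'n scalar"
  assumes smooth_L [simp]: "smooth_on D L"
    and dy_L: "\<And>k z. z \<in> D \<Longrightarrow> dy k L z = 0"
    and trace_N: "\<And>z. z \<in> D \<Longrightarrow> (\<Sum>m\<in>UNIV. N m m z) = (\<Sum>s\<in>UNIV. snd z $ s * dx s L z)"
begin

lemma dy_dx_L:
  assumes z: "z \<in> D"
  shows "dy j (dx s L) z = 0"
proof -
  have "dy j (dx s L) z = dx s (dy j L) z"
    using partial_commute(3)[OF smooth_L z] by simp
  also have "\<dots> = dx s (\<lambda>_. 0) z"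
    by (rule partial_cong(1)[OF z dy_L])
  finally show ?thesis by simp
qed

text \<open>Differentiating the trace condition vertically shows that the traced Berwald connection is an exact
  one-form on the base.\<close>

lemma trace_berwald:
  assumes z: "z \<in> D"
  shows "(\<Sum>m\<in>UNIV. \<Gamma> m m l z) = dx l L z"
proof -
  have "(\<Sum>m\<in>UNIV. \<Gamma> m m l z) = dy l (\<lambda>w. \<Sum>m\<in>UNIV. N m m w) z"
    using z by (simp add: dy_N berwald_sym[OF z, of _ _ l])
  also have "\<dots> = dy l (\<lambda>w. \<Sum>s\<in>UNIV. snd w $ s * dx s L w) z"
    by (rule partial_cong(2)[OF z trace_N])
  also have "\<dots> = dx l L z"
    using z by (simp add: dy_dx_L if_distrib[of "\<lambda>x. x * _"] cong: if_cong)
  finally show ?thesis .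
qed

text \<open>The vertical divergence is, up to sign, the curvature of the connection that the Berwald
  connection induces on volume densities; that connection preserves a density and is therefore flat.\<close>

lemma conn_curv_divergence:
  assumes z: "z \<in> D"
  shows "(\<Sum>m\<in>UNIV. dy m (conn_curv m k l) z) = 0"
proof -
  have half: "(\<Sum>m\<in>UNIV. dy m (\<delta> k (N m l)) z) =
      dx k (dx l L) z - (\<Sum>m\<in>UNIV. \<Sum>t\<in>UNIV. \<Gamma> t m k z * \<Gamma> m t l z)" for k l
  proof -
    have "dy m (\<delta> k (N m l)) z = \<delta> k (\<Gamma> m m l) z - (\<Sum>t\<in>UNIV. \<Gamma> t m k z * \<Gamma> m t l z)" for m
      using delta_dy[OF smooth_N z, of k m m l] by (simp add: dy_N)
    moreover have "(\<Sum>m\<in>UNIV. \<delta> k (\<Gamma> m m l) z) = \<delta> k (\<lambda>w. \<Sum>m\<in>UNIV. \<Gamma> m m l w) z"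
      using z by simp
    moreover have "\<delta> k (\<lambda>w. \<Sum>m\<in>UNIV. \<Gamma> m m l w) z = \<delta> k (dx l L) z"
      by (rule delta_cong[OF z trace_berwald])
    ultimately show ?thesis
      using z by (simp add: delta_dx_def dy_dx_L sum_subtractf)
  qed
  have "(\<Sum>m\<in>UNIV. \<Sum>t\<in>UNIV. \<Gamma> t m k z * \<Gamma> m t l z) = (\<Sum>m\<in>UNIV. \<Sum>t\<in>UNIV. \<Gamma> t m l z * \<Gamma> m t k z)"
    by (subst sum.swap) (simp add: mult.commute)
  then show ?thesis
    unfolding conn_curv_def[abs_def]
    using z partial_commute(1)[OF smooth_L z, of k l] by (simp add: sum_subtractf half)
qed

lemma dy_curv_trace:
  assumes z: "z \<in> D"
  shows "dy j (curv_trace l) z = dy l (curv_trace j) z"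
proof -
  have "dy l (conn_curv m j m) z = - dy l (conn_curv m m j) z" for m
    using z by (simp add: partial_cong[OF z conn_curv_antisym[of m j m]])
  then have "(\<Sum>m\<in>UNIV. dy j (conn_curv m m l) z + dy m (conn_curv m l j) z - dy l (conn_curv m m j) z) = 0"
    using bianchi_vertical[OF z, of j m m l for m] by (intro sum.neutral ballI) simp
  then show ?thesis
    unfolding curv_trace_def[abs_def]
    using z conn_curv_divergence[OF z, of l j] by (simp add: sum.distrib sum_subtractf)
qed

text \<open>By the traced vertical Bianchi identity and the vanishing vertical divergence of the curvature,
  \<open>\<rho>\<^sub>l\<^sub>\<cdot>\<^sub>k\<close> is symmetric, so that
  \<open>Ric = \<rho>\<^sub>l y\<^sup>l\<close> together with Euler's relation for \<open>\<rho>\<^sub>k\<close> gives twice \<open>\<rho>\<^sub>k\<close>.\<close>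

lemma dy_ricci_curv:
  assumes z: "z \<in> D"
  shows "dy k (ricci_curv G) z = 2 * curv_trace k z"
proof -
  have "dy k (ricci_curv G) z = (\<Sum>l\<in>UNIV. curv_trace l z * (if l = k then 1 else 0)) +
      (\<Sum>l\<in>UNIV. snd z $ l * dy l (curv_trace k) z)"
    using z by (simp add: partial_cong[OF z ricci_curv_eq] sum.distrib dy_curv_trace[OF z, of k] mult.commute)
  then show ?thesis
    using euler[OF homogeneous_curv_trace z] by (simp add: if_distrib cong: if_cong)
qed

text \<open>Both terms of \<open>\<chi>\<close> reduce to \<open>\<rho>\<^sub>k\<close>: the vertical divergence of \<open>R\<^sup>m\<^sub>k = R\<^sup>m\<^sub>k\<^sub>l y\<^sup>l\<close>
  is \<open>- \<rho>\<^sub>k\<close>, while \<open>Ric\<^sub>\<cdot>\<^sub>k = 2 \<rho>\<^sub>k\<close>.\<close>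

lemma chi_curv_zero:
  assumes z: "z \<in> D" and n: "CARD('n) \<ge> 2"
  shows "chi_curv G k z = 0"
proof -
  have "(\<Sum>m\<in>UNIV. dy m (riemann_curv G m k) z) =
      (\<Sum>m\<in>UNIV. \<Sum>l\<in>UNIV. dy m (conn_curv m k l) z * snd z $ l) + (\<Sum>m\<in>UNIV. conn_curv m k m z)"
    using z by (simp add: partial_cong[OF z riemann_curv_eq] sum.distrib if_distrib[of "\<lambda>x. _ * x"]
        cong: if_cong)
  also have "(\<Sum>m\<in>UNIV. \<Sum>l\<in>UNIV. dy m (conn_curv m k l) z * snd z $ l) =
      (\<Sum>l\<in>UNIV. (\<Sum>m\<in>UNIV. dy m (conn_curv m k l) z) * snd z $ l)"
    by (subst sum.swap) (simp add: sum_distrib_right)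
  finally show ?thesis
    using n by (simp add: chi_curv_eq[OF z] conn_curv_divergence[OF z] curv_trace_swap
        ricci_scalar_dy[OF z] dy_ricci_curv[OF z])
qed

text \<open>Once \<open>\<chi> = 0\<close>, the Weyl curvature differs from the Riemann curvature by a multiple of the
  identity and a multiple of \<open>y\<close>. The Riemann part contributes \<open>n - 1\<close> copies of the right-hand
  expression, by the contracted Bianchi identity with \<open>\<rho>\<^sub>k = (n - 1) R\<^sub>\<cdot>\<^sub>k / 2\<close>; the
  correction takes away one copy.\<close>

lemma weyl_divergence:
  assumes z: "z \<in> D" and n: "CARD('n) \<ge> 3"
  shows "(\<Sum>m\<in>UNIV. hcov_endo G (weyl_curv G) m k m z) =
    (real CARD('n) - 2) * (hcov_scalar G (ricci_scalar G) k z
      - 1 / 2 * (\<Sum>m\<in>UNIV. hcov_covector G (\<lambda>j. dy j (ricci_scalar G)) k m z * snd z $ m))"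
proof -
  let ?R = "ricci_scalar G" and ?c = "real CARD('n) - 1"
  let ?X = "\<Sum>m\<in>UNIV. hcov_covector G (\<lambda>j. dy j ?R) k m z * snd z $ m"
  have c: "?c \<noteq> 0" using n by simp
  have Ric: "ricci_curv G w = ?c * ?R w" for w
    using c by (simp add: ricci_scalar_def)
  have tr: "curv_trace j w = ?c / 2 * dy j ?R w" if "w \<in> D" for j w
    using c dy_ricci_curv[OF that] ricci_scalar_dy[OF that] by simp
  have dtr: "\<delta> m (curv_trace j) z = ?c / 2 * \<delta> m (dy j ?R) z" for m j
    using z by (simp add: delta_cong[OF z tr])
  have "(\<Sum>l\<in>UNIV. \<Gamma> l k m z * curv_trace l z) = ?c / 2 * (\<Sum>l\<in>UNIV. \<Gamma> l k m z * dy l ?R z)" for m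
    unfolding sum_distrib_left by (intro sum.cong refl) (simp add: tr[OF z] mult_ac)
  then have "hcov_covector G curv_trace k m z = ?c / 2 * hcov_covector G (\<lambda>j. dy j ?R) k m z" for m
    unfolding hcov_covector_def dtr right_diff_distrib by simp
  then have "(\<Sum>l\<in>UNIV. hcov_covector G curv_trace k l z * snd z $ l) = ?c / 2 * ?X"
    by (simp only: sum_distrib_left mult.assoc)
  moreover have "hcov_scalar G (ricci_curv G) k z = ?c * hcov_scalar G ?R k z"
    using z by (simp add: hcov_scalar_def delta_cong[OF z Ric])
  ultimately have R: "(\<Sum>m\<in>UNIV. hcov_endo G (riemann_curv G) m k m z) =
      ?c * hcov_scalar G ?R k z - ?c / 2 * ?X"
    by (simp add: bianchi_contracted[OF z])
  have "weyl_curv G i k w = riemann_curv G i k w - (?R w * (if i = k then 1 else 0)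
      - 1 / 2 * dy k ?R w * snd w $ i)" if "w \<in> D" for i k w
    using n by (simp add: weyl_curv_def chi_curv_zero[OF that])
  note hcov_endo_scalar_part[OF _ _ _ this z]
  then have "hcov_endo G (weyl_curv G) m k m z = hcov_endo G (riemann_curv G) m k m z
      - (if m = k then hcov_scalar G ?R m z else 0)
      + 1 / 2 * (hcov_covector G (\<lambda>j. dy j ?R) k m z * snd z $ m)" for m
    by simp
  then have "(\<Sum>m\<in>UNIV. hcov_endo G (weyl_curv G) m k m z) =
      (\<Sum>m\<in>UNIV. hcov_endo G (riemann_curv G) m k m z) - hcov_scalar G ?R k z + 1 / 2 * ?X"
    by (simp add: sum.distrib sum_subtractf flip: sum_divide_distrib)
  then show ?thesis unfolding R by (simp add: field_simps)
qed

end

section \<open>The associated projective spray\<close>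

lemma derivative_along_fibre_eq_0:
  fixes g :: "'a::real_normed_vector \<Rightarrow> real" and v :: "'b::real_normed_vector"
  assumes "((\<lambda>z. g (fst z)) has_derivative F) (at z)"
  shows "F (0, v) = 0"
proof -
  have "((\<lambda>t. z + (0, t *\<^sub>R v)) has_derivative (\<lambda>t. (0, t *\<^sub>R v))) (at (0::real))"
    by (auto intro!: derivative_eq_intros)
  from has_derivative_compose[OF this, of "\<lambda>z. g (fst z)" F]
  have "((\<lambda>t. g (fst z)) has_derivative (\<lambda>t. F (0, t *\<^sub>R v))) (at (0::real))"
    using assms by (simp flip: zero_prod_def)
  then have "(\<lambda>t. F (0, t *\<^sub>R v)) = (\<lambda>t. 0)"
    by (rule has_derivative_unique) simp
  from fun_cong[OF this, of 1] show ?thesis by simp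
qed

text \<open>The factor \<open>P = - S / (n + 1)\<close> of the associated projective spray is chosen so that the trace of
  \<open>N\<close> drops by \<open>S\<close>; hence the new spray has vanishing S-curvature with respect to the same
  density, while its Weyl curvature is that of \<open>G\<close>.\<close>

lemma (in local_spray) berwald_weyl_eq_divergence:
  assumes n: "CARD('n) \<ge> 3" and z: "z \<in> D"
    and smooth: "smooth_on D (\<lambda>w. ln (\<sigma> (fst w)))"
  shows "berwald_weyl G \<sigma> k z = 1 / (real CARD('n) - 2) *
    (\<Sum>m\<in>UNIV. hcov_endo (proj_spray_coeff G \<sigma>) (weyl_curv G) m k m z)"
proof -
  let ?L = "\<lambda>w. ln (\<sigma> (fst w))"
  let ?S = "S_curv G \<sigma>"
  define P where "P w = - ?S w / (real CARD('n) + 1)" for w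
  have S: "?S = (\<lambda>w. (\<Sum>m\<in>UNIV. N m m w) - (\<Sum>m\<in>UNIV. snd w $ m * dx m ?L w))"
    by (rule ext) (simp add: S_curv_def nonlin_conn_def)
  have dy_L: "dy j ?L w = 0" if "w \<in> D" for j w
  proof -
    have "(?L has_derivative frechet_derivative ?L (at w)) (at w)"
      by (rule smooth_has_derivative[OF smooth that])
    then show ?thesis unfolding dy_def by (rule derivative_along_fibre_eq_0)
  qed
  have hom_dL: "homogeneous 0 (dx m ?L)" for m
    by (rule homogeneous_dx[OF smooth]) (simp add: homogeneous_def dy_L)
  have "homogeneous (1 + 0) (\<lambda>w. snd w $ m * dx m ?L w)" for m
    using smooth by (intro homogeneous_mult homogeneous_fibre_coord hom_dL) simp_all
  then have "homogeneous 1 ?S"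
    unfolding S using smooth by (intro homogeneous_diff homogeneous_sum homogeneous_N) simp_all
  moreover have smooth_S: "smooth_on D ?S" using smooth by (simp add: S)
  ultimately have "homogeneous 1 P"
    using homogeneous_cmult[of ?S 1 "- 1 / (real CARD('n) + 1)"] by (simp add: P_def[abs_def])
  moreover have "smooth_on D P" using smooth_S by (simp add: P_def[abs_def])
  ultimately interpret pc: projective_change D G P
    by unfold_locales
  have H: "proj_spray_coeff G \<sigma> = pc.H"
    by (rule ext) (simp add: proj_spray_coeff_def pc.H_def P_def)
  interpret us: unimodular_spray D pc.H ?L
  proof
    fix w assume w: "w \<in> D"
    have "(real CARD('n) + 1) * P w = - ?S w"
      by (simp add: P_def)
    then show "(\<Sum>m\<in>UNIV. pc.H.N m m w) = (\<Sum>s\<in>UNIV. snd w $ s * dx s ?L w)"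
      unfolding pc.H_nonlin_conn_trace[OF w] by (simp add: S)
  qed (simp_all add: smooth dy_L)
  have "hcov_endo pc.H (weyl_curv G) m k m z = hcov_endo pc.H (weyl_curv pc.H) m k m z" for m
  proof -
    have W: "weyl_curv G i k w = weyl_curv pc.H i k w" if "w \<in> D" for i k w
      using pc.H_weyl_curv[OF that] n by simp
    then show ?thesis
      using pc.H.delta_cong[OF z W] z by (simp add: hcov_endo_def)
  qed
  then show ?thesis
    using us.weyl_divergence[OF z n, of k] n by (simp add: H berwald_weyl_def Let_def)
qed

section \<open>Charts of the slit tangent bundle\<close>

context
  fixes M :: "'p topology" and A :: "('p, 'e::euclidean_space) chart set"
  assumes manifold: "smooth_manifold M A"
begin

lemma chart_homeomorphism:
  assumes "c \<in> A"
  shows openin_chart_domain: "openin M (fst c)"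
    and open_chart_range: "open (snd c ` fst c)"
    and homeomorphic_map_chart:
      "homeomorphic_map (subtopology M (fst c)) (top_of_set (snd c ` fst c)) (snd c)"
proof -
  have "\<forall>c\<in>A. openin M (fst c) \<and> open (snd c ` fst c) \<and>
      homeomorphic_map (subtopology M (fst c)) (top_of_set (snd c ` fst c)) (snd c)"
    using manifold by (simp add: smooth_manifold_def)
  from bspec[OF this assms] show "openin M (fst c)" "open (snd c ` fst c)"
    "homeomorphic_map (subtopology M (fst c)) (top_of_set (snd c ` fst c)) (snd c)"
    by simp_all
qed

lemma open_chart_image:
  assumes c: "c \<in> A" and U: "openin M U" "U \<subseteq> fst c"
  shows "open (snd c ` U)"
proof -
  have "openin (subtopology M (fst c)) U"
    unfolding openin_subtopology using U by (intro exI[of _ U]) (simp add: Int_absorb2)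
  then have "openin (top_of_set (snd c ` fst c)) (snd c ` U)"
    using homeomorphic_map_openness_eq[OF homeomorphic_map_chart[OF c]] by metis
  then show ?thesis using open_chart_range[OF c] by (rule openin_open_trans)
qed

lemma chart_inv_chart [simp]:
  assumes "c \<in> A" "p \<in> fst c"
  shows "chart_inv c (snd c p) = p"
proof -
  have "inj_on (snd c) (topspace (subtopology M (fst c)))"
    using homeomorphic_map_chart[OF assms(1)] by (simp add: homeomorphic_map_def)
  moreover have "topspace (subtopology M (fst c)) = fst c"
    using openin_subset[OF openin_chart_domain[OF assms(1)]] by (simp add: Int_absorb1)
  ultimately show ?thesis
    using assms(2) by (simp add: chart_inv_def)
qed

lemma transition_has_derivative:
  assumes "c \<in> A" "d \<in> A" "p \<in> fst c" "p \<in> fst d"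
  shows "(transition c d has_derivative frechet_derivative (transition c d) (at (snd c p))) (at (snd c p))"
proof -
  have "smooth_on (snd c ` (fst c \<inter> fst d)) (transition c d)"
    using manifold assms by (simp add: smooth_manifold_def)
  then have "Ck_on (Suc 0) (snd c ` (fst c \<inter> fst d)) (transition c d)"
    unfolding smooth_on_def by blast
  then show ?thesis by (rule Ck_on_has_derivative) (use assms in blast)
qed

lemma transition_self_derivative:
  assumes "c \<in> A" "p \<in> fst c"
  shows "frechet_derivative (transition c c) (at (snd c p)) = (\<lambda>y. y)"
proof -
  have "frechet_derivative (transition c c) (at (snd c p)) = frechet_derivative (\<lambda>y. y) (at (snd c p))"
    by (rule frechet_derivative_cong_open[OF open_chart_image[OF assms(1) openin_chart_domain[OF assms(1)]]])
      (use assms in \<open>auto simp: transition_def\<close>)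
  then show ?thesis by simp
qed

text \<open>Compatibility of the Jacobians, the chain rule for coordinate changes; it makes any prescribed value in
  one chart extend to a tangent vector.\<close>

lemma transition_cocycle:
  assumes "c \<in> A" "d \<in> A" "e \<in> A" and p: "p \<in> fst c" "p \<in> fst d" "p \<in> fst e"
  shows "frechet_derivative (transition c e) (at (snd c p)) y =
    frechet_derivative (transition d e) (at (snd d p)) (frechet_derivative (transition c d) (at (snd c p)) y)"
proof -
  let ?U = "fst c \<inter> fst d \<inter> fst e"
  have "open (snd c ` ?U)"
    using assms by (intro open_chart_image openin_Int openin_chart_domain) auto
  then have "frechet_derivative (transition c e) (at (snd c p)) =
      frechet_derivative (transition d e \<circ> transition c d) (at (snd c p))"
    by (rule frechet_derivative_cong_open) (use assms in \<open>auto simp: transition_def\<close>)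
  moreover have "transition c d (snd c p) = snd d p"
    using assms by (simp add: transition_def)
  then have "(transition d e \<circ> transition c d has_derivative
      frechet_derivative (transition d e) (at (snd d p)) \<circ> frechet_derivative (transition c d) (at (snd c p)))
      (at (snd c p))"
    using assms by (intro diff_chain_at transition_has_derivative) (simp_all add: transition_has_derivative)
  ultimately show ?thesis by (simp add: frechet_derivative_eqI)
qed

lemma tangent_vector_exists:
  assumes "c \<in> A" "p \<in> fst c"
  obtains v where "v \<in> tangent_space A p" "v c = y"
proof
  let ?v = "\<lambda>d. if d \<in> A \<and> p \<in> fst d then frechet_derivative (transition c d) (at (snd c p)) y else 0"
  show "?v \<in> tangent_space A p"
    unfolding tangent_space_def mem_Collect_eq
  proof (intro conjI ballI impI allI)
    fix d e assume "d \<in> A" "e \<in> A" "p \<in> fst d" "p \<in> fst e"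
    then show "?v e = frechet_derivative (transition d e) (at (snd d p)) (?v d)"
      using transition_cocycle[of c d e p y] assms by simp
  qed auto
  show "?v c = y" using assms by (simp add: transition_self_derivative)
qed

lemma tangent_vector_eq_0:
  assumes "c \<in> A" "p \<in> fst c" "v \<in> tangent_space A p" "v c = 0"
  shows "v = (\<lambda>_. 0)"
proof
  fix d
  show "v d = 0"
  proof (cases "d \<in> A \<and> p \<in> fst d")
    case True
    then have "v d = frechet_derivative (transition c d) (at (snd c p)) (v c)"
      using assms(1-3) unfolding tangent_space_def by blast
    also have "\<dots> = frechet_derivative (transition c d) (at (snd c p)) 0"
      by (simp only: assms(4))
    also have "\<dots> = 0"
      using transition_has_derivative[of c d p] assms(1,2) True
      by (intro linear_0 has_derivative_linear) blast
    finally show ?thesis .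
  next
    case False
    then show ?thesis using assms(3) unfolding tangent_space_def by blast
  qed
qed

text \<open>The coordinate range is a full product: this makes it open and invariant under scaling of the fibre.\<close>

lemma slit_chart_image:
  assumes "c \<in> A"
  shows "snd (slit_chart A c) ` fst (slit_chart A c) = snd c ` fst c \<times> (- {0})"
proof (intro equalityI subsetI)
  fix z assume "z \<in> snd (slit_chart A c) ` fst (slit_chart A c)"
  then obtain p v where z: "z = (snd c p, v c)" and p: "p \<in> fst c"
    and v: "v \<in> tangent_space A p" "v \<noteq> (\<lambda>_. 0)"
    by (auto simp: slit_chart_def)
  then have "v c \<noteq> 0"
    using tangent_vector_eq_0[OF assms p v(1)] by blast
  then show "z \<in> snd c ` fst c \<times> (- {0})"
    using z p by simp
next
  fix z assume "z \<in> snd c ` fst c \<times> (- {0 :: 'e})"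
  then obtain p y where z: "z = (snd c p, y)" "p \<in> fst c" "y \<noteq> 0" by auto
  obtain v where v: "v \<in> tangent_space A p" "v c = y"
    using tangent_vector_exists[OF assms z(2)] .
  show "z \<in> snd (slit_chart A c) ` fst (slit_chart A c)"
  proof
    show "z = snd (slit_chart A c) (p, v)" using z v by (simp add: slit_chart_def)
    have "v \<noteq> (\<lambda>_. 0)" using z v by metis
    then show "(p, v) \<in> fst (slit_chart A c)" using z v by (simp add: slit_chart_def)
  qed
qed

end

text \<open>Differentiate the scaling law at \<open>t = 1\<close>.\<close>

lemma euler_of_scaling:
  fixes f :: "'n::finite scalar"
  assumes f: "(f has_derivative F) (at (x, y))"
    and hom: "\<And>t. t > 0 \<Longrightarrow> f (x, t *\<^sub>R y) = t ^ r * f (x, y)"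
  shows "(\<Sum>j\<in>UNIV. y $ j * dy j f (x, y)) = r * f (x, y)"
proof -
  have "((\<lambda>t. (x, t *\<^sub>R y)) has_derivative (\<lambda>t. (0, t *\<^sub>R y))) (at (1::real))"
    by (auto intro!: derivative_eq_intros)
  from has_derivative_compose[OF this, of f F] f
  have "((\<lambda>t. f (x, t *\<^sub>R y)) has_derivative (\<lambda>t. F (0, t *\<^sub>R y))) (at (1::real))"
    by simp
  then have "((\<lambda>t. t ^ r * f (x, y)) has_derivative (\<lambda>t. F (0, t *\<^sub>R y))) (at (1::real))"
    by (rule has_derivative_transform_within_open[of _ _ _ _ "{0<..}"]) (auto simp: hom)
  moreover have "((\<lambda>t. t ^ r * f (x, y)) has_derivative (\<lambda>t. t * (r * f (x, y)))) (at (1::real))"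
    by (auto intro!: derivative_eq_intros)
  ultimately have "(\<lambda>t. F (0, t *\<^sub>R y)) = (\<lambda>t. t * (r * f (x, y)))"
    by (rule has_derivative_unique)
  from fun_cong[OF this, of 1] have "F (0, y) = r * f (x, y)" by simp
  moreover have "F (0, y) = (\<Sum>j\<in>UNIV. y $ j * F (0, axis j 1))"
  proof -
    have lin: "linear F" using f by (rule has_derivative_linear)
    have "(0, y) = (\<Sum>j\<in>UNIV. y $ j *\<^sub>R (0 :: real^'n, axis j 1 :: real^'n))"
      using basis_expansion[of y]
      by (simp add: prod_eq_iff fst_sum snd_sum scalar_mult_eq_scaleR)
    then show ?thesis
      by (simp only: linear_sum[OF lin] linear_scale[OF lin] real_scaleR_def)
  qed
  ultimately show ?thesis
    by (simp add: dy_def frechet_derivative_eqI[OF f])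
qed

lemma local_spray_spray_coeff:
  fixes A :: "('p, real^'n) chart set" and X :: "('p, 'n) tm_field"
  assumes M: "smooth_manifold M A" and X: "spray A X" and c: "c \<in> A"
  shows "local_spray (snd c ` fst c \<times> (- {0})) (spray_coeff A X c)"
proof -
  let ?D = "snd c ` fst c \<times> (- {0}) :: ((real^'n) \<times> (real^'n)) set"
  have op: "open ?D"
    using open_chart_image[OF M c openin_chart_domain[OF M c]] by (intro open_Times) auto
  have "smooth_on ?D (tm_components A X c)"
    using X c slit_chart_image[OF M c]
    unfolding spray_def smooth_vector_field_def tm_components_def[abs_def] by auto
  then have smooth: "smooth_on ?D (\<lambda>z. spray_coeff A X c z $ i)" for i
    unfolding smooth_on_def spray_coeff_def
    by (intro allI Ck_on_bounded_linear_compose[OF op, where L = "\<lambda>w. ((- 1 / 2) *\<^sub>R snd w) $ i"]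
        bounded_linear_compose[OF bounded_linear_vec_nth]
        bounded_linear_compose[OF bounded_linear_scaleR_right] bounded_linear_snd) auto
  interpret coord_domain ?D
    by unfold_locales (rule op)
  show ?thesis
  proof
    fix i
    show "smooth_on ?D (\<lambda>z. spray_coeff A X c z $ i)" by (rule smooth)
    show "homogeneous 2 (\<lambda>z. spray_coeff A X c z $ i)"
      unfolding homogeneous_def
    proof
      fix z assume z: "z \<in> ?D"
      have "spray_coeff A X c (fst z, t *\<^sub>R snd z) = t\<^sup>2 *\<^sub>R spray_coeff A X c (fst z, snd z)" if "t > 0" for t
      proof -
        have "\<forall>x\<in>snd c ` fst c. \<forall>y. y \<noteq> 0 \<longrightarrow> (\<forall>t>0.
            spray_coeff A X c (x, t *\<^sub>R y) = t\<^sup>2 *\<^sub>R spray_coeff A X c (x, y))"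
          using X c unfolding spray_def by blast
        moreover have "fst z \<in> snd c ` fst c" "snd z \<noteq> 0" using z by auto
        ultimately show ?thesis using that by blast
      qed
      then have "spray_coeff A X c (fst z, t *\<^sub>R snd z) $ i = t\<^sup>2 * spray_coeff A X c (fst z, snd z) $ i"
        if "t > 0" for t using that by simp
      with euler_of_scaling[of "\<lambda>z. spray_coeff A X c z $ i" _ "fst z" "snd z" 2]
        smooth_has_derivative[OF smooth[of i] z]
      show "(\<Sum>j\<in>UNIV. snd z $ j * dy j (\<lambda>z. spray_coeff A X c z $ i) z) = 2 * spray_coeff A X c z $ i"
        by simp
    qed
  qed
qed

lemma smooth_ln_volume_density:
  fixes A :: "('p, real^'n) chart set"
  assumes M: "smooth_manifold M A" and \<mu>: "volume_form A \<mu>" and c: "c \<in> A"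
  shows "smooth_on (snd c ` fst c \<times> (- {0 :: real^'n})) (\<lambda>w. ln (volume_density \<mu> c (fst w)))"
proof -
  have op: "open (snd c ` fst c)"
    using open_chart_image[OF M c openin_chart_domain[OF M c]] by simp
  have "Ck_on k (snd c ` fst c) (volume_density \<mu> c)" for k
    using \<mu> c unfolding volume_form_def smooth_on_def volume_density_def[abs_def] by blast
  moreover have "volume_density \<mu> c x > 0" if "x \<in> snd c ` fst c" for x
  proof -
    obtain p where p: "p \<in> fst c" "x = snd c p" using \<open>x \<in> snd c ` fst c\<close> by blast
    have "\<forall>p\<in>fst c. \<mu> p c > 0"
      using \<mu> c unfolding volume_form_def by blast
    then show ?thesis
      using p by (simp add: volume_density_def chart_inv_chart[OF M c])
  qed
  ultimately have "Ck_on k (snd c ` fst c) (\<lambda>x. ln (volume_density \<mu> c x))" for k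
    using Ck_on_ln[OF op] by blast
  then have "Ck_on k (snd c ` fst c \<times> (- {0 :: real^'n})) (\<lambda>w. ln (volume_density \<mu> c (fst w)))" for k
    by (rule Ck_on_compose_fst[OF op, rotated]) auto
  then show ?thesis by (simp add: smooth_on_def)
qed

theorem proposition1p1:
  fixes M :: "'p topology"
    and A :: "('p, real^'n) chart set"
    and X :: "('p, 'n) tm_field"
    and \<mu> :: "'p \<Rightarrow> ('p, real^'n) chart \<Rightarrow> real"
    and c :: "('p, real^'n) chart"
    and p :: 'p and v :: "('p, real^'n) chart \<Rightarrow> real^'n"
    and k :: 'n
  assumes "CARD('n) \<ge> 3"
    and "smooth_manifold M A"
    and "spray A X"
    and "volume_form A \<mu>"
    and "c \<in> A"
    and "p \<in> fst c" and "v \<in> tangent_space A p" and "v \<noteq> (\<lambda>_. 0)"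
  shows
    "let G = spray_coeff A X c;
         \<sigma> = volume_density \<mu> c;
         z = (snd c p, v c)
     in berwald_weyl G \<sigma> k z =
          1 / (real CARD('n) - 2) *
          (\<Sum>m\<in>UNIV. hcov_endo (proj_spray_coeff G \<sigma>) (weyl_curv G) m k m z)"
proof -
  have "(snd c p, v c) \<in> snd c ` fst c \<times> (- {0})"
    using assms(6) tangent_vector_eq_0[OF assms(2,5,6,7)] assms(8) by auto
  from local_spray.berwald_weyl_eq_divergence[OF local_spray_spray_coeff[OF assms(2,3,5)]
      assms(1) this smooth_ln_volume_density[OF assms(2,4,5)]]
  show ?thesis by (simp add: Let_def)
qed

end
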